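(* Let $0<\lambda_1\le\lambda_2\le\dots\le\lambda_{dN}$ be the eigenvalues (counted with multiplicity) of $\widetilde{\mathsf C}^{-1}\mathsf C$, where $\mathsf C,\widetilde{\mathsf C}\in\mathbb R^{dN\times dN}$ are the finite element stiffness matrices of the original and of the preconditioning elasticity operator defined in the context. For $k=1,\dots,N$ put $$\widehat\lambda_k^{\rm L}=\operatorname*{ess\,inf}_{\boldsymbol x\in\mathcal P_k}\lambda_{\min}\big(\widetilde{\boldsymbol C}^{-1}(\boldsymbol x)\boldsymbol C(\boldsymbol x)\big),\qquad \widehat\lambda_k^{\rm U}=\operatorname*{ess\,sup}_{\boldsymbol x\in\mathcal P_k}\lambda_{\max}\big(\widetilde{\boldsymbol C}^{-1}(\boldsymbol x)\boldsymbol C(\boldsymbol x)\big),$$ and repeat every item $d$ times: $$\lambda_{(k-1)d+1}^{\rm L}=\dots=\lambda_{kd}^{\rm L}=\widehat\lambda_k^{\rm L},\qquad \lambda_{(k-1)d+1}^{\rm U}=\dots=\lambda_{kd}^{\rm U}=\widehat\lambda_k^{\rm U},\qquad k=1,\dots,N.$$ Let $r,s:\{1,\dots,dN\}\to\{1,\dots,dN\}$ be bijections sorting these two series non-decreasingly, i.e. $\lambda^{\rm L}_{r(1)}\le\dots\le\lambda^{\rm L}_{r(dN)}$ and $\lambda^{\rm U}_{s(1)}\le\dots\le\lambda^{\rm U}_{s(dN)}$. Then $$\lambda^{\rm L}_{r(k)}\le\lambda_k\le\lambda^{\rm U}_{s(k)},\qquad k=1,\dots,dN.$$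
   Context: $\Omega\subset\mathbb R^d$, $d\in\{2,3\}$, is a bounded polygonal (polyhedral) domain and $V_0=\{v\in H^1(\Omega):\ v=0\text{ on }\partial\Omega\}$ (homogeneous Dirichlet boundary conditions). Put $m=3$ if $d=2$ and $m=6$ if $d=3$. For $\boldsymbol u=(u_1,\dots,u_d)^T\in V_0^d$, the (engineering) strain vector $\boldsymbol{\partial u}\in\mathbb R^m$ is obtained by applying the $m\times d$ differential operator $$\boldsymbol\partial=\begin{pmatrix}\frac{\partial}{\partial x_1}&0\\0&\frac{\partial}{\partial x_2}\\\frac{\partial}{\partial x_2}&\frac{\partial}{\partial x_1}\end{pmatrix}\ (d=2),\qquad \boldsymbol\partial=\begin{pmatrix}\frac{\partial}{\partial x_1}&0&0\\0&\frac{\partial}{\partial x_2}&0\\0&0&\frac{\partial}{\partial x_3}\\\frac{\partial}{\partial x_2}&\frac{\partial}{\partial x_1}&0\\0&\frac{\partial}{\partial x_3}&\frac{\partial}{\partial x_2}\\\frac{\partial}{\partial x_3}&0&\frac{\partial}{\partial x_1}\end{pmatrix}\ (d=3).$$ The material data $\boldsymbol C,\widetilde{\boldsymbol C}\in L^\infty(\Omega;\mathbb R^{m\times m})$ are symmetric and uniformly positive definite in $\Omega$; $\boldsymbol C$ belongs to the original operator and $\widetilde{\boldsymbol C}$ to the preconditioning operator. $\Omega$ is decomposed into finitely many elements; $\varphi_1,\dots,\varphi_N\in V_0$ are linearly independent continuous conforming finite element basis functions, the same set being used for each component of $\boldsymbol u$; $\mathcal P_k$ denotes the smallest patch (union) of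 elements covering the support of $\varphi_k$. A vector $\mathsf v=(\mathsf v_{(1)}^T,\dots,\mathsf v_{(d)}^T)^T\in\mathbb R^{dN}$, $\mathsf v_{(i)}\in\mathbb R^N$, represents the function $\boldsymbol u_{\mathsf v}\in V_0^d$ with components $u_i=\sum_{k=1}^N(\mathsf v_{(i)})_k\varphi_k$. The symmetric matrices $\mathsf C,\widetilde{\mathsf C}\in\mathbb R^{dN\times dN}$ are given by $$\mathsf w^T\mathsf C\mathsf v=\int_\Omega(\boldsymbol\partial\boldsymbol u_{\mathsf w})^T\boldsymbol C\,\boldsymbol\partial\boldsymbol u_{\mathsf v}\,d\boldsymbol x,\qquad \mathsf w^T\widetilde{\mathsf C}\mathsf v=\int_\Omega(\boldsymbol\partial\boldsymbol u_{\mathsf w})^T\widetilde{\boldsymbol C}\,\boldsymbol\partial\boldsymbol u_{\mathsf v}\,d\boldsymbol x,\qquad \mathsf v,\mathsf w\in\mathbb R^{dN}.$$ $\lambda_{\min}$ and $\lambda_{\max}$ denote the smallest and largest eigenvalue. *)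

theory Defs
  imports
    "HOL-Analysis.Analysis"
    "HOL-Probability.Essential_Supremum"
    "Jordan_Normal_Form.Char_Poly"
    "Jordan_Normal_Form.Gauss_Jordan_Elimination"
begin

section \<open>Domain and decomposition into elements\<close>

text \<open>The boundary of a polygon (polyhedron) is a finite union of segments (convex polygons).
  Neither convexity nor a Lipschitz boundary is required.\<close>

definition polyhedral_domain :: "'a::euclidean_space set \<Rightarrow> bool" where
  "polyhedral_domain \<Omega> \<longleftrightarrow> open \<Omega> \<and> connected \<Omega> \<and> bounded \<Omega> \<and> \<Omega> \<noteq> {} \<and>
     (\<exists>F. finite F \<and> frontier \<Omega> = \<Union>F \<and>
        (\<forall>P\<in>F. polytope P \<and> aff_dim P = int DIM('a) - 1))"

text \<open>No particular shape of the elements (simplices, parallelepipeds, ...) is prescribed.\<close>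

definition element_decomposition :: "'a::euclidean_space set \<Rightarrow> 'a set set \<Rightarrow> bool" where
  "element_decomposition \<Omega> \<T> \<longleftrightarrow> finite \<T> \<and> \<Union>\<T> = closure \<Omega> \<and>
     (\<forall>T\<in>\<T>. compact T \<and> interior T \<noteq> {} \<and> closure (interior T) = T) \<and>
     (\<forall>T\<in>\<T>. \<forall>T'\<in>\<T>. T \<noteq> T' \<longrightarrow> interior T \<inter> interior T' = {})"

definition support_on :: "'a::euclidean_space set \<Rightarrow> ('a \<Rightarrow> real) \<Rightarrow> 'a set" where
  "support_on \<Omega> f = closure {x \<in> \<Omega>. f x \<noteq> 0}"

text \<open>\<open>LEAST\<close> refers to set inclusion. The least such union exists because every element is the
  closure of its interior, the interiors are disjoint and the support is the closure of an open
  set if \<open>f\<close> is continuous.\<close>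

definition smallest_patch :: "'a::euclidean_space set \<Rightarrow> 'a set set \<Rightarrow> ('a \<Rightarrow> real) \<Rightarrow> 'a set" where
  "smallest_patch \<Omega> \<T> f = (LEAST P. (\<exists>F\<subseteq>\<T>. P = \<Union>F) \<and> support_on \<Omega> f \<subseteq> P)"


section \<open>Sobolev functions\<close>

text \<open>Weak derivatives are tested, as in Evans and Gariepy, with compactly supported
  \<open>C\<^sup>1\<close> functions.\<close>

definition test_function :: "'a::euclidean_space set \<Rightarrow> ('a \<Rightarrow> real) \<Rightarrow> bool" where
  "test_function \<Omega> \<psi> \<longleftrightarrow> (\<forall>x. \<psi> differentiable (at x)) \<and>
     (\<forall>e\<in>Basis. continuous_on UNIV (\<lambda>x. frechet_derivative \<psi> (at x) e)) \<and>
     compact (closure {x. \<psi> x \<noteq> 0}) \<and> closure {x. \<psi> x \<noteq> 0} \<subseteq> \<Omega>"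

definition L2 :: "'a::euclidean_space set \<Rightarrow> ('a \<Rightarrow> 'b::euclidean_space) \<Rightarrow> bool" where
  "L2 \<Omega> f \<longleftrightarrow> f \<in> borel_measurable (lebesgue_on \<Omega>) \<and>
     integrable (lebesgue_on \<Omega>) (\<lambda>x. (norm (f x))\<^sup>2)"

definition is_weak_gradient ::
    "'a::euclidean_space set \<Rightarrow> ('a \<Rightarrow> real) \<Rightarrow> ('a \<Rightarrow> 'a) \<Rightarrow> bool" where
  "is_weak_gradient \<Omega> f g \<longleftrightarrow> L2 \<Omega> g \<and>
     (\<forall>\<psi>. test_function \<Omega> \<psi> \<longrightarrow> (\<forall>e\<in>Basis.
        (\<integral>x. f x * frechet_derivative \<psi> (at x) e \<partial>lebesgue_on \<Omega>) =
        - (\<integral>x. inner (g x) e * \<psi> x \<partial>lebesgue_on \<Omega>)))"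

definition H1 :: "'a::euclidean_space set \<Rightarrow> ('a \<Rightarrow> real) set" where
  "H1 \<Omega> = {f. L2 \<Omega> f \<and> (\<exists>g. is_weak_gradient \<Omega> f g)}"

text \<open>A representative; the weak gradient is unique up to null sets.\<close>

definition weak_gradient :: "'a::euclidean_space set \<Rightarrow> ('a \<Rightarrow> real) \<Rightarrow> 'a \<Rightarrow> 'a" where
  "weak_gradient \<Omega> f = (SOME g. is_weak_gradient \<Omega> f g)"

text \<open>The continuous members of \<open>V\<^sub>0\<close>. For functions continuous up to the boundary, the
  condition \<open>f = 0\<close> on the boundary is the pointwise one.\<close>

definition V0_cont :: "'a::euclidean_space set \<Rightarrow> ('a \<Rightarrow> real) set" where
  "V0_cont \<Omega> = {f \<in> H1 \<Omega>. continuous_on (closure \<Omega>) f \<and> (\<forall>x\<in>frontier \<Omega>. f x = 0)}"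


section \<open>Strain, material data and stiffness matrices\<close>

text \<open>Throughout, \<open>b 1, \<dots>, b d\<close> is the standard basis of the \<open>d\<close>-dimensional space \<open>'a\<close>, which
  numbers the coordinates, and a displacement \<open>u\<close> has the components \<open>u 1, \<dots>, u d\<close>.
  Vectors and matrices have indices starting from \<open>0\<close>.\<close>

definition strain ::
    "nat \<Rightarrow> (nat \<Rightarrow> 'a::euclidean_space) \<Rightarrow> 'a set \<Rightarrow> (nat \<Rightarrow> 'a \<Rightarrow> real) \<Rightarrow> 'a \<Rightarrow> real vec" where
  "strain d b \<Omega> u x = (let D = (\<lambda>j i. inner (weak_gradient \<Omega> (u i) x) (b j)) in
     if d = 2 then vec_of_list
       [D 1 1,
        D 2 2,
        D 2 1 + D 1 2]
     else vec_of_list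
       [D 1 1,
        D 2 2,
        D 3 3,
        D 2 1 + D 1 2,
        D 3 2 + D 2 3,
        D 3 1 + D 1 3])"

definition material_data ::
    "nat \<Rightarrow> 'a::euclidean_space set \<Rightarrow> ('a \<Rightarrow> real mat) \<Rightarrow> bool" where
  "material_data m \<Omega> C \<longleftrightarrow>
     (\<forall>x\<in>\<Omega>. C x \<in> carrier_mat m m) \<and>
     (\<forall>i<m. \<forall>j<m. (\<lambda>x. C x $$ (i, j)) \<in> borel_measurable (lebesgue_on \<Omega>)) \<and>
     (\<exists>K. \<forall>i<m. \<forall>j<m. AE x in lebesgue_on \<Omega>. \<bar>C x $$ (i, j)\<bar> \<le> K) \<and>
     (AE x in lebesgue_on \<Omega>. transpose_mat (C x) = C x) \<and>
     (\<exists>c>0. AE x in lebesgue_on \<Omega>. \<forall>\<xi>\<in>carrier_vec m.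
        scalar_prod \<xi> (C x *\<^sub>v \<xi>) \<ge> c * scalar_prod \<xi> \<xi>)"

text \<open>The \<open>i\<close>-th component of the function represented by a coefficient vector consisting of
  \<open>d\<close> consecutive blocks of length \<open>N\<close>.\<close>

definition fe_function :: "nat \<Rightarrow> (nat \<Rightarrow> 'a \<Rightarrow> real) \<Rightarrow> real vec \<Rightarrow> nat \<Rightarrow> 'a \<Rightarrow> real" where
  "fe_function N \<phi> v i x = (\<Sum>k=1..N. vec_index v ((i - 1) * N + (k - 1)) * \<phi> k x)"

definition is_stiffness_matrix ::
    "nat \<Rightarrow> (nat \<Rightarrow> 'a::euclidean_space) \<Rightarrow> 'a set \<Rightarrow> nat \<Rightarrow> (nat \<Rightarrow> 'a \<Rightarrow> real) \<Rightarrow>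
     ('a \<Rightarrow> real mat) \<Rightarrow> real mat \<Rightarrow> bool" where
  "is_stiffness_matrix d b \<Omega> N \<phi> C A \<longleftrightarrow> A \<in> carrier_mat (d * N) (d * N) \<and>
     (\<forall>v\<in>carrier_vec (d * N). \<forall>w\<in>carrier_vec (d * N).
        scalar_prod w (A *\<^sub>v v) =
        (\<integral>x. scalar_prod (strain d b \<Omega> (fe_function N \<phi> w) x)
                (C x *\<^sub>v strain d b \<Omega> (fe_function N \<phi> v) x) \<partial>lebesgue_on \<Omega>))"


section \<open>Eigenvalues and essential bounds\<close>

definition inv_mat :: "real mat \<Rightarrow> real mat" where
  "inv_mat A = the (mat_inverse A)"

definition lambda_min :: "real mat \<Rightarrow> real" where
  "lambda_min A = Min {e. eigenvalue A e}"

definition lambda_max :: "real mat \<Rightarrow> real" where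
  "lambda_max A = Max {e. eigenvalue A e}"

text \<open>All real eigenvalues in non-decreasing order, repeated according to their (algebraic)
  multiplicity.\<close>

definition eigenvalue_list :: "real mat \<Rightarrow> real list" where
  "eigenvalue_list A = sorted_list_of_multiset (proots (char_poly A))"

definition ess_sup_on :: "'a::euclidean_space set \<Rightarrow> ('a \<Rightarrow> real) \<Rightarrow> ereal" where
  "ess_sup_on P f = esssup (lebesgue_on P) (\<lambda>x. ereal (f x))"

definition ess_inf_on :: "'a::euclidean_space set \<Rightarrow> ('a \<Rightarrow> real) \<Rightarrow> ereal" where
  "ess_inf_on P f = - esssup (lebesgue_on P) (\<lambda>x. - ereal (f x))"

end

theory Submission
  imports Defs
begin

text \<open>
  Let \<open>n = d * N\<close>. The bounds follow from the Courant-Fischer principle, with subspaces on which some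
  coefficients of the finite element function are zero.

  Let \<open>t\<close> be a real number below the \<open>k\<close>-th smallest lower bound. If the \<open>k - 1\<close> coefficients
  that belong to the smaller bounds are zero, the function \<open>u\<^sub>v\<close> lives on the patches of nodes whose
  bounds are at least \<open>t\<close>. On these patches the form of the material matrix \<open>C x\<close> is almost everywhere at
  least \<open>t\<close> times that of \<open>Ct x\<close> (\<open>lambda_min_pencil_form_le\<close>), and elsewhere the strain is zero
  (\<open>strain_eq_0_off_patches\<close>). Integration gives the same inequality for the stiffness
  matrices \<open>A\<close> and \<open>At\<close> on a subspace of codimension at most \<open>k - 1\<close>, whence the \<open>k\<close>-th
  eigenvalue is at least \<open>t\<close> (\<open>eigenvalue_lower_bound\<close>). For the upper bound, the coefficients of
  the \<open>n - k\<close> largest upper bounds are set to zero (\<open>eigenvalue_upper_bound\<close>).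

  Two ingredients are analytic. The weak gradient of a function vanishes almost everywhere on an
  open set on which the function vanishes; this is the locality of weak derivatives together with the
  fundamental lemma of the calculus of variations. Moreover the stiffness matrices have
  to be positive definite, that is, a finite element function with zero strain must be zero.
  This can be read off from the diagonal strain components: if they vanish, each component
  \<open>u\<^sub>i\<close> has a zero derivative in the direction \<open>x\<^sub>i\<close>, so the continuous function \<open>u\<^sub>i\<close> is constant along
  lines in this direction up to the boundary, where it vanishes
  (\<open>eq_0_if_weak_directional_derivative_0\<close>).

  The algebraic ingredient is the spectral theorem for \<open>A v = \<mu> B v\<close> with \<open>A\<close> symmetric and \<open>B\<close> symmetric
  positive definite (\<open>generalized_spectral_theorem\<close>), proved by successive minimization of the Rayleigh
  quotient. It identifies the sorted list of eigenvalues of \<open>B\<^sup>-\<^sup>1 A\<close> with their algebraic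
  multiplicities (\<open>eigenvalue_list_pencil\<close>).
\<close>

no_notation Finite_Cartesian_Product.vec.vec_nth (infixl "$" 90)

section \<open>Quadratic forms and linear systems\<close>

text \<open>The explicit double sum makes scaling, symmetry and continuity of the quadratic forms
  evident.\<close>

lemma scalar_prod_mult_mat_vec:
  fixes M :: "real mat"
  assumes "M \<in> carrier_mat n n" "v \<in> carrier_vec n" "w \<in> carrier_vec n"
  shows "scalar_prod v (M *\<^sub>v w) = (\<Sum>i<n. \<Sum>j<n. vec_index v i * M $$ (i, j) * vec_index w j)"
  using assms
  by (auto simp: scalar_prod_def mult_mat_vec_def sum_distrib_left lessThan_atLeast0 ac_simps
      intro!: sum.cong)

lemma bilinear_form_symmetric:
  fixes M :: "real mat"
  assumes M: "M \<in> carrier_mat n n" "transpose_mat M = M"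
    and v: "v \<in> carrier_vec n" and w: "w \<in> carrier_vec n"
  shows "scalar_prod v (M *\<^sub>v w) = scalar_prod w (M *\<^sub>v v)"
proof -
  have "M $$ (j, i) = M $$ (i, j)" if "i < n" "j < n" for i j
    using arg_cong[OF M(2), of "\<lambda>X. X $$ (i, j)"] M(1) that by simp
  then have "(\<Sum>i<n. \<Sum>j<n. vec_index v i * M $$ (i, j) * vec_index w j)
      = (\<Sum>i<n. \<Sum>j<n. vec_index w j * M $$ (j, i) * vec_index v i)"
    by (auto intro!: sum.cong simp: ac_simps)
  also have "\<dots> = (\<Sum>j<n. \<Sum>i<n. vec_index w j * M $$ (j, i) * vec_index v i)"
    by (rule sum.swap)
  finally show ?thesis
    using scalar_prod_mult_mat_vec[OF M(1) v w] scalar_prod_mult_mat_vec[OF M(1) w v] by simp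
qed

definition lin_comb :: "nat \<Rightarrow> nat set \<Rightarrow> (nat \<Rightarrow> real) \<Rightarrow> (nat \<Rightarrow> real vec) \<Rightarrow> real vec" where
  "lin_comb n I c e = vec n (\<lambda>l. \<Sum>i\<in>I. c i * vec_index (e i) l)"

lemma lin_comb_carrier [simp]: "lin_comb n I c e \<in> carrier_vec n"
  by (simp add: lin_comb_def)

lemma scalar_prod_lin_comb:
  assumes "u \<in> carrier_vec n" "\<And>i. i \<in> I \<Longrightarrow> e i \<in> carrier_vec n"
  shows "scalar_prod u (lin_comb n I c e) = (\<Sum>i\<in>I. c i * scalar_prod u (e i))"
proof -
  have "scalar_prod u (lin_comb n I c e)
      = (\<Sum>l<n. \<Sum>i\<in>I. vec_index u l * (c i * vec_index (e i) l))"
    by (auto simp: scalar_prod_def lin_comb_def sum_distrib_left lessThan_atLeast0 intro!: sum.cong)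
  also have "\<dots> = (\<Sum>i\<in>I. \<Sum>l<n. vec_index u l * (c i * vec_index (e i) l))"
    by (rule sum.swap)
  also have "\<dots> = (\<Sum>i\<in>I. c i * scalar_prod u (e i))"
  proof (rule sum.cong)
    fix i assume "i \<in> I"
    then have "dim_vec (e i) = n" using assms(2) by auto
    then show "(\<Sum>l<n. vec_index u l * (c i * vec_index (e i) l)) = c i * scalar_prod u (e i)"
      by (auto simp: scalar_prod_def sum_distrib_left lessThan_atLeast0 ac_simps intro!: sum.cong)
  qed simp
  finally show ?thesis .
qed

text \<open>The square matrix with the rows \<open>f 0, \<dots>, f (k - 1), 0, \<dots>, 0\<close> has a zero row, hence a nonzero
  vector in its kernel.\<close>

lemma exists_orthogonal_vector:
  fixes f :: "nat \<Rightarrow> real vec"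
  assumes "k < n" "\<And>i. i < k \<Longrightarrow> f i \<in> carrier_vec n"
  shows "\<exists>v\<in>carrier_vec n. v \<noteq> 0\<^sub>v n \<and> (\<forall>i<k. scalar_prod (f i) v = 0)"
proof -
  define g where "g i = (if i < k then f i else 0\<^sub>v n)" for i
  define M where "M = mat\<^sub>r n n g"
  have M: "M \<in> carrier_mat n n" by (simp add: M_def)
  have g: "g i \<in> carrier_vec n" for i using assms(2) by (auto simp: g_def)
  have rM: "row M i = g i" if "i < n" for i
    using that g by (simp add: M_def)
  have "transpose_mat M *\<^sub>v unit_vec n (n - 1) = 0\<^sub>v n"
  proof (rule eq_vecI)
    fix i assume "i < dim_vec (0\<^sub>v n :: real vec)"
    then have i: "i < n" by simp
    have "scalar_prod (col M i) (unit_vec n (n - 1)) = col M i $ (n - 1)"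
      using assms(1) M by (intro scalar_prod_right_unit) auto
    also have "\<dots> = row M (n - 1) $ i" using M i assms(1) by auto
    also have "\<dots> = 0" using rM[of "n - 1"] assms(1) i by (auto simp: g_def)
    finally show "(transpose_mat M *\<^sub>v unit_vec n (n - 1)) $ i = 0\<^sub>v n $ i"
      using i M by simp
  qed (use M in auto)
  moreover have "unit_vec n (n - 1) \<noteq> (0\<^sub>v n :: real vec)" using assms(1) by simp
  ultimately have "det (transpose_mat M) = 0"
    using det_0_iff_vec_prod_zero[of "transpose_mat M" n] M by (metis transpose_carrier_mat unit_vec_carrier)
  then have "det M = 0" using M by (simp add: det_transpose)
  then obtain v where v: "v \<in> carrier_vec n" "v \<noteq> 0\<^sub>v n" "M *\<^sub>v v = 0\<^sub>v n"
    using det_0_iff_vec_prod_zero[OF M] by auto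
  have "scalar_prod (f i) v = 0" if "i < k" for i
  proof -
    have "(M *\<^sub>v v) $ i = 0" using v that assms(1) by simp
    then show ?thesis using rM[of i] that assms(1) M by (simp add: g_def)
  qed
  with v show ?thesis by blast
qed

text \<open>Fewer homogeneous equations, indexed by \<open>J\<close>, than unknowns, indexed by \<open>I\<close>.\<close>

lemma exists_lin_comb_vanishing:
  fixes g :: "nat \<Rightarrow> nat \<Rightarrow> real"
  assumes "finite I" "finite J" "card J < card I"
  shows "\<exists>c. (\<exists>i\<in>I. c i \<noteq> 0) \<and> (\<forall>j\<in>J. (\<Sum>i\<in>I. c i * g i j) = 0)"
proof -
  obtain p where p: "bij_betw p I {..<card I}"
    using ex_bij_betw_finite_nat[OF assms(1)] by (auto simp: lessThan_atLeast0)
  obtain q where q: "bij_betw q {..<card J} J"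
    using ex_bij_betw_nat_finite[OF assms(2)] by (auto simp: lessThan_atLeast0)
  define f where "f l = vec (card I) (\<lambda>i. g (the_inv_into I p i) (q l))" for l
  obtain v where v: "v \<in> carrier_vec (card I)" "v \<noteq> 0\<^sub>v (card I)"
      "\<And>l. l < card J \<Longrightarrow> scalar_prod (f l) v = 0"
    using exists_orthogonal_vector[OF assms(3), of f] by (auto simp: f_def)
  have inv: "the_inv_into I p (p i) = i" if "i \<in> I" for i
    using that p by (simp add: bij_betw_def the_inv_into_f_f)
  have p_less: "p i < card I" if "i \<in> I" for i
    using bij_betwE[OF p] that by blast
  have "(\<Sum>i\<in>I. v $ p i * g i j) = 0" if "j \<in> J" for j
  proof -
    have "j \<in> q ` {..<card J}" using q that by (simp add: bij_betw_imp_surj_on)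
    then obtain l where l: "l < card J" "q l = j" by auto
    have "(\<Sum>i\<in>I. v $ p i * g i j) = (\<Sum>i\<in>I. f l $ (p i) * v $ (p i))"
      using l by (intro sum.cong) (simp_all add: f_def inv p_less)
    also have "\<dots> = (\<Sum>i<card I. f l $ i * v $ i)"
      using p by (rule sum.reindex_bij_betw)
    also have "\<dots> = scalar_prod (f l) v"
      using v(1) by (simp add: scalar_prod_def lessThan_atLeast0)
    finally show ?thesis using v(3)[OF l(1)] by simp
  qed
  moreover have "\<exists>i\<in>I. v $ p i \<noteq> 0"
  proof (rule ccontr)
    assume "\<not> ?thesis"
    then have *: "\<forall>i\<in>I. v $ p i = 0" by blast
    have "v $ l = 0" if "l < card I" for l
    proof -
      have "l \<in> p ` I" using p that by (simp add: bij_betw_imp_surj_on)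
      then show ?thesis using * by auto
    qed
    then show False using v(1,2) by (auto intro!: eq_vecI)
  qed
  ultimately show ?thesis by (intro exI[of _ "\<lambda>i. v $ p i"]) simp
qed

section \<open>The spectral theorem for a pencil of symmetric matrices\<close>

text \<open>Vectors of a dimension that is not a type carry no topology. They are represented by functions on
  \<open>nat\<close> that vanish from \<open>n\<close> on; in the product topology the unit sphere of these is a closed
  subset of a product of compact intervals.\<close>

lemma compact_unit_sphere_constraints:
  fixes f :: "nat \<Rightarrow> real vec"
  shows "compact {x :: nat \<Rightarrow> real. (\<forall>i. x i \<in> (if i < n then {-1..1} else {0})) \<and>
      (\<Sum>i<n. (x i)\<^sup>2) = 1 \<and> (\<forall>i<k. (\<Sum>j<n. f i $ j * x j) = 0)}"
proof -
  have "compact (PiE UNIV (\<lambda>i. if i < n then {-1..1} else {0 :: real}))"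
    using compactin_PiE[of "\<lambda>_. euclidean" UNIV "\<lambda>i. if i < n then {-1..1} else {0 :: real}"]
    by (auto simp: euclidean_product_topology)
  moreover have "closed {x :: nat \<Rightarrow> real. (\<Sum>i<n. (x i)\<^sup>2) = 1 \<and>
      (\<forall>i<k. (\<Sum>j<n. f i $ j * x j) = 0)}"
    by (intro closed_Collect_conj closed_Collect_all closed_Collect_imp closed_Collect_eq
        continuous_intros continuous_on_product_coordinates) auto
  ultimately have "compact (PiE UNIV (\<lambda>i. if i < n then {-1..1} else {0 :: real}) \<inter>
      {x :: nat \<Rightarrow> real. (\<Sum>i<n. (x i)\<^sup>2) = 1 \<and> (\<forall>i<k. (\<Sum>j<n. f i $ j * x j) = 0)})"
    by (rule compact_Int_closed)
  then show ?thesis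
    by (simp only: PiE_UNIV_domain Pi_def Int_def mem_Collect_eq UNIV_I simp_thms)
qed

text \<open>The quotient of the two forms is continuous on the compact unit sphere of the subspace that is
  orthogonal to all \<open>f i\<close>, and it does not change under scaling, so its minimum on the sphere is a
  minimum on the whole subspace. The minimizer is then rescaled. Constraining the vectors by
  orthogonality lets the same lemma provide the first eigenvector and all later ones.\<close>

lemma rayleigh_minimizer:
  fixes A B :: "real mat"
  assumes A: "A \<in> carrier_mat n n" and B: "B \<in> carrier_mat n n"
    and pos: "\<And>v. v \<in> carrier_vec n \<Longrightarrow> v \<noteq> 0\<^sub>v n \<Longrightarrow> 0 < scalar_prod v (B *\<^sub>v v)"
    and f: "\<And>i. i < k \<Longrightarrow> f i \<in> carrier_vec n" and "k < n"
  shows "\<exists>v\<in>carrier_vec n. (\<forall>i<k. scalar_prod (f i) v = 0) \<and> scalar_prod v (B *\<^sub>v v) = 1 \<and>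
    (\<forall>w\<in>carrier_vec n. (\<forall>i<k. scalar_prod (f i) w = 0) \<longrightarrow>
       scalar_prod v (A *\<^sub>v v) * scalar_prod w (B *\<^sub>v w) \<le> scalar_prod w (A *\<^sub>v w))"
proof -
  define K where "K = {x :: nat \<Rightarrow> real. (\<forall>i. x i \<in> (if i < n then {-1..1} else {0})) \<and>
      (\<Sum>i<n. (x i)\<^sup>2) = 1 \<and> (\<forall>i<k. (\<Sum>j<n. f i $ j * x j) = 0)}"
  define a where "a v = scalar_prod v (A *\<^sub>v v)" for v
  define q where "q v = scalar_prod v (B *\<^sub>v v)" for v
  have scale: "a (c \<cdot>\<^sub>v v) = c\<^sup>2 * a v" "q (c \<cdot>\<^sub>v v) = c\<^sup>2 * q v" if "v \<in> carrier_vec n" for c v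
    using that A B
    by (auto simp: a_def q_def scalar_prod_mult_mat_vec power2_eq_square sum_distrib_left ac_simps
        intro!: sum.cong)
  have nz: "vec n x \<noteq> 0\<^sub>v n" if "x \<in> K" for x
  proof
    assume "vec n x = 0\<^sub>v n"
    then have "x i = 0" if "i < n" for i using that by (metis index_vec index_zero_vec(1))
    then show False using \<open>x \<in> K\<close> by (simp add: K_def)
  qed
  have normalize: "\<exists>x\<in>K. \<exists>c. c \<noteq> 0 \<and> w = c \<cdot>\<^sub>v vec n x"
    if w: "w \<in> carrier_vec n" "w \<noteq> 0\<^sub>v n" "\<forall>i<k. scalar_prod (f i) w = 0" for w
  proof -
    define s where "s = (\<Sum>i<n. (w $ i)\<^sup>2)"
    have le: "(w $ i)\<^sup>2 \<le> s" if "i < n" for i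
      unfolding s_def using that by (intro member_le_sum) auto
    have "\<exists>i<n. w $ i \<noteq> 0" using w(1,2) by (metis carrier_vecD eq_vecI index_zero_vec)
    then obtain i where "i < n" "w $ i \<noteq> 0" by blast
    then have "0 < (w $ i)\<^sup>2" "(w $ i)\<^sup>2 \<le> s" using le by auto
    then have s: "0 < s" by linarith
    define x where "x i = (if i < n then w $ i / sqrt s else 0)" for i
    have wx: "w = sqrt s \<cdot>\<^sub>v vec n x"
      using w(1) s by (intro eq_vecI) (auto simp: x_def)
    have abs_x: "\<bar>x i\<bar> \<le> 1" for i
    proof -
      have "\<bar>w $ i\<bar> \<le> sqrt s" if "i < n"
        using le[OF that] by (metis real_le_rsqrt power2_abs)
      then show ?thesis using s by (auto simp: x_def)
    qed
    have 1: "x i \<in> (if i < n then {-1..1} else {0})" for i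
      using abs_x[of i] by (cases "i < n") (simp_all add: abs_le_iff, simp add: x_def)
    have 2: "(\<Sum>i<n. (x i)\<^sup>2) = 1"
    proof -
      have "(\<Sum>i<n. (x i)\<^sup>2) = (\<Sum>i<n. (w $ i)\<^sup>2) / s"
        using s by (simp add: x_def power_divide sum_divide_distrib)
      then show ?thesis using s by (simp add: s_def)
    qed
    have 3: "(\<Sum>j<n. f i $ j * x j) = 0" if "i < k" for i
    proof -
      have "(\<Sum>j<n. f i $ j * x j) = scalar_prod (f i) w / sqrt s"
        using w(1) by (simp add: x_def scalar_prod_def sum_divide_distrib lessThan_atLeast0)
      then show ?thesis using w(3) that by simp
    qed
    show ?thesis
      using 1 2 3 wx s by (intro bexI[of _ x] exI[of _ "sqrt s"]) (auto simp: K_def)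
  qed
  have "compact K" unfolding K_def by (rule compact_unit_sphere_constraints)
  moreover have "K \<noteq> {}"
    using exists_orthogonal_vector[OF \<open>k < n\<close>, of f] f normalize by blast
  moreover have "continuous_on K (\<lambda>x. a (vec n x) / q (vec n x))"
  proof (intro continuous_on_divide)
    show "\<forall>x\<in>K. q (vec n x) \<noteq> 0" using nz pos by (force simp: q_def)
    have cont: "continuous_on K (\<lambda>x. scalar_prod (vec n x) (M *\<^sub>v vec n x))"
      if "M \<in> carrier_mat n n" for M
      using that
      by (auto simp: scalar_prod_mult_mat_vec[OF that] intro!: continuous_intros
          continuous_on_subset[OF continuous_on_product_coordinates])
    show "continuous_on K (\<lambda>x. a (vec n x))" "continuous_on K (\<lambda>x. q (vec n x))"
      unfolding a_def q_def using cont A B by auto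
  qed
  ultimately obtain x where x: "x \<in> K"
      "\<And>y. y \<in> K \<Longrightarrow> a (vec n x) / q (vec n x) \<le> a (vec n y) / q (vec n y)"
    using continuous_attains_inf[of K "\<lambda>x. a (vec n x) / q (vec n x)"] by blast
  have qx: "0 < q (vec n x)" using pos nz[OF x(1)] by (simp add: q_def)
  define v where "v = (1 / sqrt (q (vec n x))) \<cdot>\<^sub>v vec n x"
  have v: "v \<in> carrier_vec n" by (simp add: v_def)
  have qv: "q v = 1" and av: "a v = a (vec n x) / q (vec n x)"
    using qx by (simp_all add: v_def scale power_divide)
  have orth: "scalar_prod (f i) v = 0" if "i < k" for i
  proof -
    have "scalar_prod (f i) v = (\<Sum>j<n. f i $ j * x j) * (1 / sqrt (q (vec n x)))"
      by (simp add: v_def scalar_prod_def lessThan_atLeast0 sum_distrib_right sum_divide_distrib)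
    then show ?thesis using x(1) that by (simp add: K_def)
  qed
  have "a v * q w \<le> a w"
    if w: "w \<in> carrier_vec n" "\<forall>i<k. scalar_prod (f i) w = 0" for w
  proof (cases "w = 0\<^sub>v n")
    case True
    then show ?thesis using A B by (simp add: a_def q_def scalar_prod_mult_mat_vec)
  next
    case False
    then obtain y c where y: "y \<in> K" "c \<noteq> 0" "w = c \<cdot>\<^sub>v vec n y"
      using normalize w by blast
    have "a v \<le> a (vec n y) / q (vec n y)" using x(2)[OF y(1)] av by simp
    moreover have "0 < q (vec n y)" using pos nz[OF y(1)] by (simp add: q_def)
    ultimately have "a v * q (vec n y) \<le> a (vec n y)" by (simp add: field_simps)
    then have "c\<^sup>2 * (a v * q (vec n y)) \<le> c\<^sup>2 * a (vec n y)" by (simp add: mult_left_mono)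
    then show ?thesis using y(3) by (simp add: scale ac_simps)
  qed
  with v qv orth show ?thesis unfolding a_def q_def by blast
qed

lemma nonneg_quadratic_imp_linear_coeff_zero:
  fixes p r :: real
  assumes "\<And>t. 0 \<le> 2 * t * p + t\<^sup>2 * r"
  shows "p = 0"
proof (rule ccontr)
  assume "p \<noteq> 0"
  have r: "0 \<le> r" using assms[of 1] assms[of "-1"] by simp
  define t where "t = - p / (r + 1)"
  have p: "p = - (t * (r + 1))" using r by (simp add: t_def)
  have "2 * t * p + t\<^sup>2 * r = - (t\<^sup>2 * (r + 2))"
    by (subst p) (simp add: power2_eq_square algebra_simps)
  moreover have "t \<noteq> 0" using \<open>p \<noteq> 0\<close> r by (simp add: t_def)
  ultimately show False using assms[of t] r
    by (smt (verit) mult_pos_pos zero_less_power2)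
qed

text \<open>The first variation: \<open>v\<close> minimizes the form of \<open>A - \<rho> B\<close> along the line through \<open>v\<close> in the
  direction \<open>w\<close>, so the derivative along this line vanishes at \<open>v\<close>.\<close>

lemma form_minimizer_stationary:
  fixes A B :: "real mat"
  assumes A: "A \<in> carrier_mat n n" "transpose_mat A = A"
    and B: "B \<in> carrier_mat n n" "transpose_mat B = B"
    and v: "v \<in> carrier_vec n" and w: "w \<in> carrier_vec n"
    and v0: "scalar_prod v (A *\<^sub>v v) = \<rho> * scalar_prod v (B *\<^sub>v v)"
    and ge: "\<And>t. \<rho> * scalar_prod (v + t \<cdot>\<^sub>v w) (B *\<^sub>v (v + t \<cdot>\<^sub>v w))
        \<le> scalar_prod (v + t \<cdot>\<^sub>v w) (A *\<^sub>v (v + t \<cdot>\<^sub>v w))"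
  shows "scalar_prod w (A *\<^sub>v v) = \<rho> * scalar_prod w (B *\<^sub>v v)"
proof -
  have ex: "scalar_prod (v + t \<cdot>\<^sub>v w) (M *\<^sub>v (v + t \<cdot>\<^sub>v w)) = scalar_prod v (M *\<^sub>v v)
      + 2 * t * scalar_prod w (M *\<^sub>v v) + t\<^sup>2 * scalar_prod w (M *\<^sub>v w)"
    if M: "M \<in> carrier_mat n n" "transpose_mat M = M" for M t
  proof -
    have [simp]: "M *\<^sub>v (v + t \<cdot>\<^sub>v w) = M *\<^sub>v v + t \<cdot>\<^sub>v (M *\<^sub>v w)"
      using M v w by (simp add: mult_add_distrib_mat_vec[of _ n n] mult_mat_vec[of _ n n])
    show ?thesis
      using M v w bilinear_form_symmetric[OF M v w]
      by (simp add: scalar_prod_add_distrib[of _ n] add_scalar_prod_distrib[of _ n]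
          power2_eq_square algebra_simps)
  qed
  have "0 \<le> 2 * t * (scalar_prod w (A *\<^sub>v v) - \<rho> * scalar_prod w (B *\<^sub>v v))
      + t\<^sup>2 * (scalar_prod w (A *\<^sub>v w) - \<rho> * scalar_prod w (B *\<^sub>v w))" for t
    using ge[of t] v0 unfolding ex[OF A] ex[OF B] by (simp add: algebra_simps)
  from nonneg_quadratic_imp_linear_coeff_zero[OF this] show ?thesis by simp
qed

lemma vec_eq_if_scalar_prods_eq:
  fixes u v :: "real vec"
  assumes "u \<in> carrier_vec n" "v \<in> carrier_vec n"
    and "\<And>w. w \<in> carrier_vec n \<Longrightarrow> scalar_prod w u = scalar_prod w v"
  shows "u = v"
proof (rule eq_vecI)
  fix i assume "i < dim_vec v"
  then show "u $ i = v $ i" using assms(1,2) assms(3)[of "unit_vec n i"] by simp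
qed (use assms in simp)

text \<open>The first \<open>k\<close> eigenpairs of the problem \<open>A v = \<mu> B v\<close>, with eigenvectors that are orthonormal for the
  inner product given by \<open>B\<close>.\<close>

definition pencil_eigensystem ::
    "nat \<Rightarrow> real mat \<Rightarrow> real mat \<Rightarrow> nat \<Rightarrow> (nat \<Rightarrow> real vec) \<Rightarrow> (nat \<Rightarrow> real) \<Rightarrow> bool" where
  "pencil_eigensystem n A B k e \<mu> \<longleftrightarrow>
     (\<forall>i<k. e i \<in> carrier_vec n \<and> A *\<^sub>v e i = \<mu> i \<cdot>\<^sub>v (B *\<^sub>v e i)) \<and>
     (\<forall>i<k. \<forall>j<k. scalar_prod (e i) (B *\<^sub>v e j) = (if i = j then 1 else 0)) \<and>
     (\<forall>i j. i \<le> j \<longrightarrow> j < k \<longrightarrow> \<mu> i \<le> \<mu> j)"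

text \<open>The eigenvectors are found one after the other, each by minimizing the quotient of the forms over
  the \<open>B\<close>-orthogonal complement of the previous ones. The equation \<open>A v = \<rho> B v\<close> for the new minimizer
  \<open>v\<close> is tested with an arbitrary vector: on the complement it is the first variation, and on
  the previous eigenvectors both sides vanish by symmetry. Since the complements shrink, the
  minima come in non-decreasing order; the induction carries the lower bound for
  the form of \<open>A\<close> on the current complement, which is what this needs.\<close>

lemma generalized_spectral_theorem:
  fixes A B :: "real mat"
  assumes A: "A \<in> carrier_mat n n" "transpose_mat A = A"
    and B: "B \<in> carrier_mat n n" "transpose_mat B = B"
    and pos: "\<And>v. v \<in> carrier_vec n \<Longrightarrow> v \<noteq> 0\<^sub>v n \<Longrightarrow> 0 < scalar_prod v (B *\<^sub>v v)"
  shows "\<exists>e \<mu>. pencil_eigensystem n A B n e \<mu>"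
proof -
  have "\<exists>e \<mu>. pencil_eigensystem n A B k e \<mu> \<and>
      (\<forall>w\<in>carrier_vec n. (\<forall>i<k. scalar_prod (B *\<^sub>v e i) w = 0) \<longrightarrow>
         (\<forall>i<k. \<mu> i * scalar_prod w (B *\<^sub>v w) \<le> scalar_prod w (A *\<^sub>v w)))"
    if "k \<le> n" for k
    using that
  proof (induction k)
    case 0
    then show ?case by (simp add: pencil_eigensystem_def)
  next
    case (Suc k)
    then obtain e \<mu> where sys: "pencil_eigensystem n A B k e \<mu>"
      and low: "\<And>w i. w \<in> carrier_vec n \<Longrightarrow> (\<forall>i<k. scalar_prod (B *\<^sub>v e i) w = 0) \<Longrightarrow> i < k \<Longrightarrow>
         \<mu> i * scalar_prod w (B *\<^sub>v w) \<le> scalar_prod w (A *\<^sub>v w)"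
      by fastforce
    have e: "e i \<in> carrier_vec n" "A *\<^sub>v e i = \<mu> i \<cdot>\<^sub>v (B *\<^sub>v e i)" if "i < k" for i
      using sys that by (auto simp: pencil_eigensystem_def)
    have on: "scalar_prod (e i) (B *\<^sub>v e j) = (if i = j then 1 else 0)" if "i < k" "j < k" for i j
      using sys that by (auto simp: pencil_eigensystem_def)
    have Be: "B *\<^sub>v e i \<in> carrier_vec n" if "i < k" for i using B e that by simp
    obtain v where v: "v \<in> carrier_vec n" "\<And>i. i < k \<Longrightarrow> scalar_prod (B *\<^sub>v e i) v = 0"
        "scalar_prod v (B *\<^sub>v v) = 1"
      and vmin: "\<And>w. w \<in> carrier_vec n \<Longrightarrow> (\<forall>i<k. scalar_prod (B *\<^sub>v e i) w = 0) \<Longrightarrow>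
         scalar_prod v (A *\<^sub>v v) * scalar_prod w (B *\<^sub>v w) \<le> scalar_prod w (A *\<^sub>v w)"
      using rayleigh_minimizer[OF A(1) B(1) pos, of k "\<lambda>i. B *\<^sub>v e i"] Be Suc.prems
      by (metis Suc_le_lessD)
    define \<rho> where "\<rho> = scalar_prod v (A *\<^sub>v v)"
    have vBe: "scalar_prod (e i) (B *\<^sub>v v) = 0" if "i < k" for i
      using v(1,2) that e Be bilinear_form_symmetric[OF B e(1)[OF that] v(1)]
      by (simp add: comm_scalar_prod[of _ n])
    have orth_W: "scalar_prod w (A *\<^sub>v v) = \<rho> * scalar_prod w (B *\<^sub>v v)"
      if w: "w \<in> carrier_vec n" "\<forall>i<k. scalar_prod (B *\<^sub>v e i) w = 0" for w
    proof (rule form_minimizer_stationary[OF A B v(1) w(1)])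
      show "scalar_prod v (A *\<^sub>v v) = \<rho> * scalar_prod v (B *\<^sub>v v)" by (simp add: \<rho>_def v(3))
      fix t
      have "\<forall>i<k. scalar_prod (B *\<^sub>v e i) (v + t \<cdot>\<^sub>v w) = 0"
        using v w Be by (auto simp: scalar_prod_add_distrib[of _ n] scalar_prod_smult_distrib[of _ n])
      then show "\<rho> * scalar_prod (v + t \<cdot>\<^sub>v w) (B *\<^sub>v (v + t \<cdot>\<^sub>v w))
          \<le> scalar_prod (v + t \<cdot>\<^sub>v w) (A *\<^sub>v (v + t \<cdot>\<^sub>v w))"
        using v w vmin unfolding \<rho>_def by simp
    qed
    have orth_e: "scalar_prod (e i) (A *\<^sub>v v) = 0" if "i < k" for i
    proof -
      have "scalar_prod (e i) (A *\<^sub>v v) = scalar_prod v (\<mu> i \<cdot>\<^sub>v (B *\<^sub>v e i))"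
        using bilinear_form_symmetric[OF A e(1)[OF that] v(1)] e(2)[OF that] by simp
      also have "\<dots> = \<mu> i * scalar_prod (e i) (B *\<^sub>v v)"
        using bilinear_form_symmetric[OF B e(1)[OF that] v(1)] v(1) Be[OF that] by simp
      finally show ?thesis using vBe[OF that] by simp
    qed
    have "A *\<^sub>v v = \<rho> \<cdot>\<^sub>v (B *\<^sub>v v)"
    proof (rule vec_eq_if_scalar_prods_eq)
      fix y :: "real vec" assume y: "y \<in> carrier_vec n"
      \<comment> \<open>\<open>z\<close> is the \<open>B\<close>-orthogonal projection of \<open>y\<close> onto the previous eigenvectors.\<close>
      define z where "z = lin_comb n {..<k} (\<lambda>i. scalar_prod (B *\<^sub>v e i) y) e"
      define w where "w = y - z"
      have z: "z \<in> carrier_vec n" by (simp add: z_def)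
      then have w: "w \<in> carrier_vec n" using y by (simp add: w_def)
      have Bz: "scalar_prod (B *\<^sub>v e i) z = scalar_prod (B *\<^sub>v e i) y" if "i < k" for i
      proof -
        have "scalar_prod (B *\<^sub>v e i) z = (\<Sum>j<k. scalar_prod (B *\<^sub>v e j) y * scalar_prod (B *\<^sub>v e i) (e j))"
          unfolding z_def using Be e that by (subst scalar_prod_lin_comb) auto
        also have "\<dots> = (\<Sum>j<k. if j = i then scalar_prod (B *\<^sub>v e j) y else 0)"
          using on that Be e by (intro sum.cong) (auto simp: comm_scalar_prod[of "B *\<^sub>v e i" n])
        finally show ?thesis using that by simp
      qed
      have "scalar_prod (B *\<^sub>v e i) w = 0" if "i < k" for i
        using Bz[OF that] Be[OF that] y z by (simp add: w_def scalar_prod_minus_distrib[of _ n])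
      then have 1: "scalar_prod w (A *\<^sub>v v) = \<rho> * scalar_prod w (B *\<^sub>v v)"
        using orth_W w by blast
      have 2: "scalar_prod z u = 0" if "u \<in> carrier_vec n" "\<And>i. i < k \<Longrightarrow> scalar_prod (e i) u = 0" for u
      proof -
        have "scalar_prod z u = scalar_prod u z" using that z by (simp add: comm_scalar_prod[of _ n])
        also have "\<dots> = 0"
          unfolding z_def using that e
          by (subst scalar_prod_lin_comb) (auto simp: comm_scalar_prod[of u n])
        finally show ?thesis .
      qed
      have "y = w + z" using y z by (intro eq_vecI) (auto simp: w_def)
      then show "scalar_prod y (A *\<^sub>v v) = scalar_prod y (\<rho> \<cdot>\<^sub>v (B *\<^sub>v v))"
        using 1 2[of "A *\<^sub>v v"] 2[of "B *\<^sub>v v"] orth_e vBe A B v w z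
        by (simp add: add_scalar_prod_distrib[of _ n])
    qed (use A B v in auto)
    define e' where "e' = e(k := v)"
    define \<mu>' where "\<mu>' = \<mu>(k := \<rho>)"
    have "\<mu> i \<le> \<rho>" if "i < k" for i
      using low[of v i] v that by (simp add: \<rho>_def)
    moreover have "scalar_prod v (B *\<^sub>v e i) = 0" if "i < k" for i
      using v(1,2) Be that by (simp add: comm_scalar_prod[of _ n])
    moreover have "\<mu> i \<le> \<mu> j" if "i \<le> j" "j < k" for i j
      using sys that by (auto simp: pencil_eigensystem_def)
    ultimately have "pencil_eigensystem n A B (Suc k) e' \<mu>'"
      unfolding pencil_eigensystem_def
      using e on v vBe \<open>A *\<^sub>v v = \<rho> \<cdot>\<^sub>v (B *\<^sub>v v)\<close>
      by (auto simp: e'_def \<mu>'_def less_Suc_eq)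
    moreover have "\<mu>' i * scalar_prod w (B *\<^sub>v w) \<le> scalar_prod w (A *\<^sub>v w)"
      if "w \<in> carrier_vec n" "\<forall>i<Suc k. scalar_prod (B *\<^sub>v e' i) w = 0" "i < Suc k" for w i
    proof -
      have "\<forall>i<k. scalar_prod (B *\<^sub>v e i) w = 0"
        using that(2) by (auto simp: e'_def less_Suc_eq split: if_splits)
      then show ?thesis
        using low[of w i] vmin[of w] that by (auto simp: \<mu>'_def \<rho>_def less_Suc_eq)
    qed
    ultimately show ?case by blast
  qed
  from this[of n] show ?thesis by blast
qed

section \<open>Eigenvalue bounds from form inequalities on coordinate subspaces\<close>

lemma pencil_eigensystem_forms:
  assumes sys: "pencil_eigensystem n A B n e \<mu>" and A: "A \<in> carrier_mat n n" and B: "B \<in> carrier_mat n n"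
    and I: "I \<subseteq> {..<n}"
  shows "scalar_prod (lin_comb n I c e) (B *\<^sub>v lin_comb n I c e) = (\<Sum>i\<in>I. (c i)\<^sup>2)"
    and "scalar_prod (lin_comb n I c e) (A *\<^sub>v lin_comb n I c e) = (\<Sum>i\<in>I. \<mu> i * (c i)\<^sup>2)"
proof -
  let ?v = "lin_comb n I c e"
  have fin: "finite I" using I finite_subset by blast
  have less: "i < n" if "i \<in> I" for i using that I by auto
  have e: "e i \<in> carrier_vec n" "A *\<^sub>v e i = \<mu> i \<cdot>\<^sub>v (B *\<^sub>v e i)" if "i \<in> I" for i
    using sys less[OF that] by (auto simp: pencil_eigensystem_def)
  have on: "scalar_prod (e i) (B *\<^sub>v e j) = (if i = j then 1 else 0)" if "i \<in> I" "j \<in> I" for i j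
    using sys less[OF that(1)] less[OF that(2)] by (simp add: pencil_eigensystem_def)
  have Mv: "M *\<^sub>v ?v = lin_comb n I c (\<lambda>i. M *\<^sub>v e i)" if M: "M \<in> carrier_mat n n" for M
  proof (rule eq_vecI)
    fix l assume "l < dim_vec (lin_comb n I c (\<lambda>i. M *\<^sub>v e i))"
    then have l: "l < n" by (simp add: lin_comb_def)
    then have "(M *\<^sub>v ?v) $ l = scalar_prod (row M l) ?v" using M by simp
    also have "\<dots> = (\<Sum>i\<in>I. c i * scalar_prod (row M l) (e i))"
      using M l e by (intro scalar_prod_lin_comb) auto
    finally show "(M *\<^sub>v ?v) $ l = lin_comb n I c (\<lambda>i. M *\<^sub>v e i) $ l"
      using M l by (simp add: lin_comb_def)
  qed (use M in \<open>auto simp: lin_comb_def\<close>)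
  have form: "scalar_prod ?v (M *\<^sub>v ?v) = (\<Sum>i\<in>I. c i * (\<Sum>j\<in>I. c j * scalar_prod (e j) (M *\<^sub>v e i)))"
    if M: "M \<in> carrier_mat n n" for M
  proof -
    have "scalar_prod ?v (M *\<^sub>v e i) = (\<Sum>j\<in>I. c j * scalar_prod (e j) (M *\<^sub>v e i))" if "i \<in> I" for i
    proof -
      have "scalar_prod ?v (M *\<^sub>v e i) = scalar_prod (M *\<^sub>v e i) ?v"
        using M e that by (intro comm_scalar_prod[of _ n]) auto
      also have "\<dots> = (\<Sum>j\<in>I. c j * scalar_prod (M *\<^sub>v e i) (e j))"
        using M e that by (intro scalar_prod_lin_comb) auto
      also have "\<dots> = (\<Sum>j\<in>I. c j * scalar_prod (e j) (M *\<^sub>v e i))"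
        using M e that by (intro sum.cong) (auto simp: comm_scalar_prod[of "M *\<^sub>v e i" n])
      finally show ?thesis .
    qed
    moreover have "scalar_prod ?v (M *\<^sub>v ?v) = (\<Sum>i\<in>I. c i * scalar_prod ?v (M *\<^sub>v e i))"
      unfolding Mv[OF M] using M e by (intro scalar_prod_lin_comb) auto
    ultimately show ?thesis by simp
  qed
  have cB: "(\<Sum>j\<in>I. c j * scalar_prod (e j) (B *\<^sub>v e i)) = c i" if "i \<in> I" for i
  proof -
    have "(\<Sum>j\<in>I. c j * scalar_prod (e j) (B *\<^sub>v e i)) = (\<Sum>j\<in>I. if j = i then c j else 0)"
      using on that by (intro sum.cong) auto
    then show ?thesis using that fin by simp
  qed
  have cA: "(\<Sum>j\<in>I. c j * scalar_prod (e j) (A *\<^sub>v e i)) = \<mu> i * c i" if "i \<in> I" for i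
  proof -
    have "(\<Sum>j\<in>I. c j * scalar_prod (e j) (A *\<^sub>v e i))
        = (\<Sum>j\<in>I. \<mu> i * (c j * scalar_prod (e j) (B *\<^sub>v e i)))"
      using e that B by (intro sum.cong) auto
    also have "\<dots> = \<mu> i * c i"
      using cB[OF that] by (simp flip: sum_distrib_left)
    finally show ?thesis .
  qed
  show "scalar_prod ?v (B *\<^sub>v ?v) = (\<Sum>i\<in>I. (c i)\<^sup>2)"
    and "scalar_prod ?v (A *\<^sub>v ?v) = (\<Sum>i\<in>I. \<mu> i * (c i)\<^sup>2)"
    using form[OF A] form[OF B] by (simp_all add: cA cB power2_eq_square ac_simps)
qed

text \<open>The span of the eigenvectors in \<open>I\<close> has dimension \<open>card I\<close>; the vectors whose coordinates in \<open>J\<close>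
  vanish form a subspace of codimension \<open>card J\<close>. If the former number is larger, the two
  subspaces have a nonzero vector in common.\<close>

lemma pencil_eigenspace_meets_coordinate_subspace:
  assumes sys: "pencil_eigensystem n A B n e \<mu>" and A: "A \<in> carrier_mat n n" and B: "B \<in> carrier_mat n n"
    and I: "I \<subseteq> {..<n}" and J: "J \<subseteq> {..<n}" and card: "card J < card I"
  obtains v c where "v \<in> carrier_vec n" "\<forall>j\<in>J. v $ j = 0" "0 < (\<Sum>i\<in>I. (c i)\<^sup>2)"
    "scalar_prod v (B *\<^sub>v v) = (\<Sum>i\<in>I. (c i)\<^sup>2)" "scalar_prod v (A *\<^sub>v v) = (\<Sum>i\<in>I. \<mu> i * (c i)\<^sup>2)"
proof -
  have fin: "finite I" "finite J" using I J finite_subset by blast+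
  obtain c where c: "\<exists>i\<in>I. c i \<noteq> 0" "\<forall>j\<in>J. (\<Sum>i\<in>I. c i * e i $ j) = 0"
    using exists_lin_comb_vanishing[OF fin card, of "\<lambda>i j. e i $ j"] by blast
  have "\<forall>j\<in>J. lin_comb n I c e $ j = 0"
    using c(2) J by (auto simp: lin_comb_def)
  moreover have "0 < (\<Sum>i\<in>I. (c i)\<^sup>2)"
    using c(1) fin by (auto intro: sum_pos2)
  ultimately show ?thesis
    using pencil_eigensystem_forms[OF sys A B I, of c]
    by (intro that[of "lin_comb n I c e" c]) simp_all
qed

text \<open>Half of the Courant-Fischer principle, with coordinate subspaces as competitors and eigenvalues
  counted from \<open>0\<close>. On the span of the first \<open>k + 1\<close> eigenvectors the form of \<open>A\<close> is at most \<open>\<mu> k\<close>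
  times that of \<open>B\<close>, and this span contains a nonzero vector to which the assumed
  inequality applies.\<close>

lemma eigenvalue_lower_bound:
  assumes sys: "pencil_eigensystem n A B n e \<mu>" and A: "A \<in> carrier_mat n n" and B: "B \<in> carrier_mat n n"
    and J: "J \<subseteq> {..<n}" "card J \<le> k" and "k < n"
    and ge: "\<And>v. v \<in> carrier_vec n \<Longrightarrow> \<forall>j\<in>J. v $ j = 0 \<Longrightarrow>
      t * scalar_prod v (B *\<^sub>v v) \<le> scalar_prod v (A *\<^sub>v v)"
  shows "t \<le> \<mu> k"
proof -
  have "{..k} \<subseteq> {..<n}" "card J < card {..k}" using J \<open>k < n\<close> by auto
  then obtain v c where v: "v \<in> carrier_vec n" "\<forall>j\<in>J. v $ j = 0" and pos: "0 < (\<Sum>i\<le>k. (c i)\<^sup>2)"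
    and f: "scalar_prod v (B *\<^sub>v v) = (\<Sum>i\<le>k. (c i)\<^sup>2)" "scalar_prod v (A *\<^sub>v v) = (\<Sum>i\<le>k. \<mu> i * (c i)\<^sup>2)"
    using pencil_eigenspace_meets_coordinate_subspace[OF sys A B _ J(1)] by blast
  have "(\<Sum>i\<le>k. \<mu> i * (c i)\<^sup>2) \<le> (\<Sum>i\<le>k. \<mu> k * (c i)\<^sup>2)"
    using sys \<open>k < n\<close> by (intro sum_mono mult_right_mono) (auto simp: pencil_eigensystem_def)
  then have "t * (\<Sum>i\<le>k. (c i)\<^sup>2) \<le> \<mu> k * (\<Sum>i\<le>k. (c i)\<^sup>2)"
    using ge[OF v] f by (simp add: sum_distrib_left)
  then show ?thesis using pos by simp
qed

text \<open>The other half uses the span of the eigenvectors \<open>k, \<dots>, n - 1\<close>, where the form of \<open>A\<close> is at least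
  \<open>\<mu> k\<close> times that of \<open>B\<close>.\<close>

lemma eigenvalue_upper_bound:
  assumes sys: "pencil_eigensystem n A B n e \<mu>" and A: "A \<in> carrier_mat n n" and B: "B \<in> carrier_mat n n"
    and J: "J \<subseteq> {..<n}" "card J < n - k" and "k < n"
    and le: "\<And>v. v \<in> carrier_vec n \<Longrightarrow> \<forall>j\<in>J. v $ j = 0 \<Longrightarrow>
      scalar_prod v (A *\<^sub>v v) \<le> t * scalar_prod v (B *\<^sub>v v)"
  shows "\<mu> k \<le> t"
proof -
  have "{k..<n} \<subseteq> {..<n}" "card J < card {k..<n}" using J by auto
  then obtain v c where v: "v \<in> carrier_vec n" "\<forall>j\<in>J. v $ j = 0"
    and pos: "0 < (\<Sum>i=k..<n. (c i)\<^sup>2)"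
    and f: "scalar_prod v (B *\<^sub>v v) = (\<Sum>i=k..<n. (c i)\<^sup>2)"
      "scalar_prod v (A *\<^sub>v v) = (\<Sum>i=k..<n. \<mu> i * (c i)\<^sup>2)"
    using pencil_eigenspace_meets_coordinate_subspace[OF sys A B _ J(1)] by blast
  have "(\<Sum>i=k..<n. \<mu> k * (c i)\<^sup>2) \<le> (\<Sum>i=k..<n. \<mu> i * (c i)\<^sup>2)"
    using sys \<open>k < n\<close> by (intro sum_mono mult_right_mono) (auto simp: pencil_eigensystem_def)
  then have "\<mu> k * (\<Sum>i=k..<n. (c i)\<^sup>2) \<le> t * (\<Sum>i=k..<n. (c i)\<^sup>2)"
    using le[OF v] f by (simp add: sum_distrib_left)
  then show ?thesis using pos by simp
qed

section \<open>Eigenvalues of the preconditioned matrix\<close>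

lemma inv_mat_of_positive_definite:
  fixes B :: "real mat"
  assumes B: "B \<in> carrier_mat n n"
    and pos: "\<And>v. v \<in> carrier_vec n \<Longrightarrow> v \<noteq> 0\<^sub>v n \<Longrightarrow> 0 < scalar_prod v (B *\<^sub>v v)"
  shows "inv_mat B \<in> carrier_mat n n" "inv_mat B * B = 1\<^sub>m n" "B * inv_mat B = 1\<^sub>m n"
proof -
  have "det B \<noteq> 0"
  proof
    assume "det B = 0"
    then obtain v where v: "v \<in> carrier_vec n" "v \<noteq> 0\<^sub>v n" "B *\<^sub>v v = 0\<^sub>v n"
      using det_0_iff_vec_prod_zero[OF B] by auto
    then show False using pos[of v] by simp
  qed
  then have "B \<in> Units (ring_mat TYPE(real) n ())" by (rule det_non_zero_imp_unit[OF B])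
  then obtain X where "mat_inverse B = Some X"
    using mat_inverse(1)[OF B, where b = "()"] by (cases "mat_inverse B") auto
  with mat_inverse(2)[OF B this]
  show "inv_mat B \<in> carrier_mat n n" "inv_mat B * B = 1\<^sub>m n" "B * inv_mat B = 1\<^sub>m n"
    by (auto simp: inv_mat_def)
qed

text \<open>The matrix \<open>E\<close> with the eigenvectors as columns satisfies \<open>E\<^sup>T B E = 1\<close> and
  \<open>A E = B E D\<close> with a diagonal matrix \<open>D\<close>. Thus \<open>B\<^sup>-\<^sup>1 A = E D E\<^sup>-\<^sup>1\<close>, and the algebraic
  multiplicities can be read off from \<open>D\<close>.\<close>

lemma eigenvalue_list_pencil:
  fixes A B :: "real mat"
  assumes sys: "pencil_eigensystem n A B n e \<mu>"
    and A: "A \<in> carrier_mat n n" and B: "B \<in> carrier_mat n n"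
    and pos: "\<And>v. v \<in> carrier_vec n \<Longrightarrow> v \<noteq> 0\<^sub>v n \<Longrightarrow> 0 < scalar_prod v (B *\<^sub>v v)"
  shows "eigenvalue_list (inv_mat B * A) = map \<mu> [0..<n]"
proof -
  note inv = inv_mat_of_positive_definite[OF B pos, simplified]
  have e: "e i \<in> carrier_vec n" "A *\<^sub>v e i = \<mu> i \<cdot>\<^sub>v (B *\<^sub>v e i)" if "i < n" for i
    using sys that by (auto simp: pencil_eigensystem_def)
  have on: "scalar_prod (e i) (B *\<^sub>v e j) = (if i = j then 1 else 0)" if "i < n" "j < n" for i j
    using sys that by (auto simp: pencil_eigensystem_def)
  define E where "E = mat_of_cols n (map e [0..<n])"
  define D where "D = mat n n (\<lambda>(i, j). if i = j then \<mu> i else 0)"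
  define F where "F = transpose_mat E * B"
  have E: "E \<in> carrier_mat n n"
    using mat_of_cols_carrier(1)[of n "map e [0..<n]"] by (simp add: E_def)
  have D: "D \<in> carrier_mat n n" by (simp add: D_def)
  have F: "F \<in> carrier_mat n n" using E B by (simp add: F_def)
  have colE: "col E i = e i" if "i < n" for i
    using that e by (simp add: E_def)
  have FE: "F * E = 1\<^sub>m n"
  proof (rule eq_matI)
    fix i j assume "i < dim_row (1\<^sub>m n :: real mat)" "j < dim_col (1\<^sub>m n :: real mat)"
    then have ij: "i < n" "j < n" by auto
    have "F * E = transpose_mat E * (B * E)" using E B by (simp add: F_def)
    then have "(F * E) $$ (i, j) = scalar_prod (e i) (col (B * E) j)"
      using ij E B colE by simp
    also have "col (B * E) j = B *\<^sub>v e j" using col_mult2[OF B E ij(2)] colE[OF ij(2)] by simp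
    finally show "(F * E) $$ (i, j) = 1\<^sub>m n $$ (i, j)" using on ij by simp
  qed (use E F in auto)
  then have EF: "E * F = 1\<^sub>m n" using mat_mult_left_right_inverse[OF F E] by simp
  have AE: "(inv_mat B * A) * E = E * D"
  proof (rule eq_matI)
    fix i j assume "i < dim_row (E * D)" "j < dim_col (E * D)"
    then have ij: "i < n" "j < n" using E D by auto
    have "col (inv_mat B * A * E) j = (inv_mat B * A) *\<^sub>v e j"
      using col_mult2[OF mult_carrier_mat[OF inv(1) A] E ij(2)] colE[OF ij(2)] by simp
    also have "\<dots> = inv_mat B *\<^sub>v (\<mu> j \<cdot>\<^sub>v (B *\<^sub>v e j))"
      using e ij A inv by (metis assoc_mult_mat_vec)
    also have "\<dots> = \<mu> j \<cdot>\<^sub>v ((inv_mat B * B) *\<^sub>v e j)"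
      using e ij B inv(1) by (simp add: mult_mat_vec[of _ n n])
    also have "\<dots> = \<mu> j \<cdot>\<^sub>v e j" using inv e ij by simp
    finally have 1: "col (inv_mat B * A * E) j = \<mu> j \<cdot>\<^sub>v e j" .
    have "(inv_mat B * A * E) $$ (i, j) = col (inv_mat B * A * E) j $ i"
      using ij inv A E by simp
    also have "\<dots> = \<mu> j * e j $ i" unfolding 1 using ij e[of j] by simp
    also have "\<dots> = (\<Sum>l<n. E $$ (i, l) * (if l = j then \<mu> l else 0))"
      using ij e by (simp add: E_def mat_of_cols_def if_distrib[of "\<lambda>x. _ * x"] cong: if_cong)
    also have "\<dots> = (E * D) $$ (i, j)"
      using ij E D by (auto simp: scalar_prod_def D_def lessThan_atLeast0 intro!: sum.cong)
    finally show "(inv_mat B * A * E) $$ (i, j) = (E * D) $$ (i, j)" .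
  qed (use E D inv A in auto)
  have "inv_mat B * A = inv_mat B * A * (E * F)" unfolding EF using inv A by simp
  also have "\<dots> = E * D * F" using assoc_mult_mat[OF mult_carrier_mat[OF inv(1) A] E F] AE by simp
  finally have "similar_mat (inv_mat B * A) D"
    using EF FE inv A E F D unfolding similar_mat_def similar_mat_wit_def Let_def
    by (intro exI[of _ E] exI[of _ F]) auto
  then have "char_poly (inv_mat B * A) = char_poly D" by (rule char_poly_similar)
  also have "\<dots> = (\<Prod>a\<leftarrow>diag_mat D. [:- a, 1:])"
    by (rule char_poly_upper_triangular[OF D]) (auto simp: D_def upper_triangular_def)
  also have "diag_mat D = map \<mu> [0..<n]" by (auto simp: diag_mat_def D_def)
  finally have cp: "char_poly (inv_mat B * A) = (\<Prod>a\<leftarrow>map \<mu> [0..<n]. [:- a, 1:])" .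
  have roots: "proots (\<Prod>a\<leftarrow>xs. [:- a, 1:]) = mset xs" for xs :: "real list"
  proof (induction xs)
    case (Cons x xs)
    have "(\<Prod>a\<leftarrow>xs. [:- a, 1:]) \<noteq> 0" by (auto simp: prod_list_zero_iff)
    with Cons show ?case by (simp add: proots_mult del: mult_pCons_left)
  qed simp
  have "eigenvalue_list (inv_mat B * A) = sort (map \<mu> [0..<n])"
    by (simp only: eigenvalue_list_def cp roots sorted_list_of_multiset_mset)
  moreover have "sorted (map \<mu> [0..<n])"
    using sys by (auto simp: pencil_eigensystem_def sorted_iff_nth_mono)
  ultimately show ?thesis by (simp add: sorted_sort_id)
qed

text \<open>The minimum of the quotient of the forms over all nonzero vectors is itself an eigenvalue.\<close>

lemma least_pencil_eigenvalue:
  fixes A B :: "real mat"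
  assumes A: "A \<in> carrier_mat n n" "transpose_mat A = A"
    and B: "B \<in> carrier_mat n n" "transpose_mat B = B"
    and pos: "\<And>v. v \<in> carrier_vec n \<Longrightarrow> v \<noteq> 0\<^sub>v n \<Longrightarrow> 0 < scalar_prod v (B *\<^sub>v v)"
    and "0 < n"
  shows "\<exists>\<rho>. eigenvalue (inv_mat B * A) \<rho> \<and>
    (\<forall>v\<in>carrier_vec n. \<rho> * scalar_prod v (B *\<^sub>v v) \<le> scalar_prod v (A *\<^sub>v v))"
proof -
  note inv = inv_mat_of_positive_definite[OF B(1) pos, simplified]
  obtain u where u: "u \<in> carrier_vec n" "scalar_prod u (B *\<^sub>v u) = 1"
    and min: "\<And>w. w \<in> carrier_vec n \<Longrightarrow>
      scalar_prod u (A *\<^sub>v u) * scalar_prod w (B *\<^sub>v w) \<le> scalar_prod w (A *\<^sub>v w)"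
    using rayleigh_minimizer[OF A(1) B(1) pos, of 0 undefined] \<open>0 < n\<close> by auto
  define \<rho> where "\<rho> = scalar_prod u (A *\<^sub>v u)"
  have "A *\<^sub>v u = \<rho> \<cdot>\<^sub>v (B *\<^sub>v u)"
  proof (rule vec_eq_if_scalar_prods_eq)
    fix w :: "real vec" assume w: "w \<in> carrier_vec n"
    have "scalar_prod w (A *\<^sub>v u) = \<rho> * scalar_prod w (B *\<^sub>v u)"
      by (rule form_minimizer_stationary[OF A B u(1) w]) (use u w min in \<open>auto simp: \<rho>_def\<close>)
    then show "scalar_prod w (A *\<^sub>v u) = scalar_prod w (\<rho> \<cdot>\<^sub>v (B *\<^sub>v u))"
      using w u B by (simp add: scalar_prod_smult_distrib[of _ n])
  qed (use A B u in auto)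
  then have "(inv_mat B * A) *\<^sub>v u = inv_mat B *\<^sub>v (\<rho> \<cdot>\<^sub>v (B *\<^sub>v u))"
    using assoc_mult_mat_vec[OF inv(1) A(1) u(1)] by simp
  also have "\<dots> = \<rho> \<cdot>\<^sub>v (inv_mat B * B *\<^sub>v u)"
    using assoc_mult_mat_vec[OF inv(1) B(1) u(1)] mult_mat_vec[OF inv(1)] B u by simp
  also have "\<dots> = \<rho> \<cdot>\<^sub>v u" using inv u by simp
  finally have "(inv_mat B * A) *\<^sub>v u = \<rho> \<cdot>\<^sub>v u" .
  moreover have "u \<noteq> 0\<^sub>v n"
    using u(2) B by auto
  ultimately have "eigenvalue (inv_mat B * A) \<rho>"
    unfolding eigenvalue_def eigenvector_def using u inv by auto
  then show ?thesis using min unfolding \<rho>_def by blast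
qed

lemma finite_eigenvalues:
  fixes M :: "real mat"
  assumes M: "M \<in> carrier_mat n n"
  shows "finite {e. eigenvalue M e}"
proof -
  have "char_poly M \<noteq> 0" using degree_monic_char_poly[OF M] by auto
  then show ?thesis
    unfolding eigenvalue_root_char_poly[OF M] by (rule poly_roots_finite)
qed

lemma lambda_min_pencil_form_le:
  fixes A B :: "real mat"
  assumes A: "A \<in> carrier_mat n n" "transpose_mat A = A"
    and B: "B \<in> carrier_mat n n" "transpose_mat B = B"
    and pos: "\<And>v. v \<in> carrier_vec n \<Longrightarrow> v \<noteq> 0\<^sub>v n \<Longrightarrow> 0 < scalar_prod v (B *\<^sub>v v)"
    and "0 < n" and v: "v \<in> carrier_vec n" and t: "t \<le> lambda_min (inv_mat B * A)"
  shows "t * scalar_prod v (B *\<^sub>v v) \<le> scalar_prod v (A *\<^sub>v v)"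
proof -
  note inv = inv_mat_of_positive_definite[OF B(1) pos, simplified]
  obtain \<rho> where \<rho>: "eigenvalue (inv_mat B * A) \<rho>"
      "\<rho> * scalar_prod v (B *\<^sub>v v) \<le> scalar_prod v (A *\<^sub>v v)"
    using least_pencil_eigenvalue[OF A B pos \<open>0 < n\<close>] v by blast
  have "lambda_min (inv_mat B * A) \<le> \<rho>"
    unfolding lambda_min_def
    using \<rho>(1) finite_eigenvalues[OF mult_carrier_mat[OF inv(1) A(1)]] by (intro Min_le) auto
  moreover have "0 \<le> scalar_prod v (B *\<^sub>v v)"
    using pos[OF v] B by (cases "v = 0\<^sub>v n") auto
  ultimately show ?thesis
    using \<rho>(2) mult_right_mono[of t \<rho> "scalar_prod v (B *\<^sub>v v)"] t by linarith
qed

text \<open>This follows from the least eigenvalue of the pencil with \<open>- A\<close> in place of \<open>A\<close>.\<close>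

lemma form_le_lambda_max_pencil:
  fixes A B :: "real mat"
  assumes A: "A \<in> carrier_mat n n" "transpose_mat A = A"
    and B: "B \<in> carrier_mat n n" "transpose_mat B = B"
    and pos: "\<And>v. v \<in> carrier_vec n \<Longrightarrow> v \<noteq> 0\<^sub>v n \<Longrightarrow> 0 < scalar_prod v (B *\<^sub>v v)"
    and "0 < n" and v: "v \<in> carrier_vec n" and t: "lambda_max (inv_mat B * A) \<le> t"
  shows "scalar_prod v (A *\<^sub>v v) \<le> t * scalar_prod v (B *\<^sub>v v)"
proof -
  note inv = inv_mat_of_positive_definite[OF B(1) pos, simplified]
  have nA: "- A \<in> carrier_mat n n" "transpose_mat (- A) = - A"
    using A by (auto simp: transpose_uminus)
  have neg: "(- M) *\<^sub>v w = - (M *\<^sub>v w)" if "M \<in> carrier_mat n n" "w \<in> carrier_vec n" for M :: "real mat" and w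
    using that by (intro eq_vecI) auto
  obtain \<rho> where \<rho>: "eigenvalue (inv_mat B * - A) \<rho>"
      "\<rho> * scalar_prod v (B *\<^sub>v v) \<le> scalar_prod v (- A *\<^sub>v v)"
    using least_pencil_eigenvalue[OF nA B pos \<open>0 < n\<close>] v by blast
  have IA: "inv_mat B * A \<in> carrier_mat n n" using inv A by simp
  have "inv_mat B * - A = - (inv_mat B * A)" using inv A by (metis uminus_mult_right_mat carrier_matD)
  then obtain u where u: "u \<in> carrier_vec n" "u \<noteq> 0\<^sub>v n" "- (inv_mat B * A) *\<^sub>v u = \<rho> \<cdot>\<^sub>v u"
    using \<rho>(1) IA unfolding eigenvalue_def eigenvector_def by auto
  have "(inv_mat B * A) *\<^sub>v u = - \<rho> \<cdot>\<^sub>v u"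
  proof -
    have "(inv_mat B * A) *\<^sub>v u = - (- (inv_mat B * A) *\<^sub>v u)"
      using neg[OF IA u(1)] IA u by (intro eq_vecI) auto
    also have "\<dots> = - \<rho> \<cdot>\<^sub>v u" unfolding u(3) using u(1) by (intro eq_vecI) auto
    finally show ?thesis .
  qed
  then have "eigenvalue (inv_mat B * A) (- \<rho>)"
    unfolding eigenvalue_def eigenvector_def using u IA inv by auto
  then have "- \<rho> \<le> lambda_max (inv_mat B * A)"
    unfolding lambda_max_def using finite_eigenvalues[OF IA] by (intro Max_ge) auto
  moreover have "0 \<le> scalar_prod v (B *\<^sub>v v)"
    using pos[OF v] B by (cases "v = 0\<^sub>v n") auto
  moreover have "scalar_prod v (- A *\<^sub>v v) = - scalar_prod v (A *\<^sub>v v)"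
    using A v by (simp add: neg scalar_prod_uminus_right)
  ultimately show ?thesis
    using \<rho>(2) mult_right_mono[of "- \<rho>" t "scalar_prod v (B *\<^sub>v v)"] t by (simp add: neg)
qed

section \<open>Test functions of product form\<close>

lemma has_real_derivative_pos_part_squared:
  "((\<lambda>t. (max 0 t)\<^sup>2) has_real_derivative 2 * max 0 t) (at (t :: real))"
proof -
  consider "t > 0" | "t < 0" | "t = 0" by linarith
  then show ?thesis
  proof cases
    case 1
    have "((\<lambda>t. t\<^sup>2) has_real_derivative 2 * max 0 t) (at t)"
      using 1 by (auto intro!: derivative_eq_intros)
    then show ?thesis
      by (rule has_field_derivative_transform_within_open[of _ _ _ "{0<..}"]) (use 1 in auto)
  next
    case 2
    have "((\<lambda>t. 0) has_real_derivative 2 * max 0 t) (at t)"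
      using 2 by auto
    then show ?thesis
      by (rule has_field_derivative_transform_within_open[of _ _ _ "{..<0}"]) (use 2 in auto)
  next
    case 3
    have "(\<lambda>h. (max 0 h)\<^sup>2 / h) \<midarrow>0\<rightarrow> (0 :: real)"
    proof (rule Lim_null_comparison)
      show "\<forall>\<^sub>F h in at 0. norm ((max 0 h)\<^sup>2 / h) \<le> \<bar>h :: real\<bar>"
        by (rule always_eventually) (auto simp: max_def power2_eq_square)
      show "((\<lambda>h. \<bar>h :: real\<bar>) \<longlongrightarrow> 0) (at 0)"
        using tendsto_rabs_zero_iff[of "\<lambda>h. h" "at (0::real)"] by simp
    qed
    then show ?thesis using 3 by (simp add: DERIV_def)
  qed
qed

lemmas derivative_pos_part_squared =
  DERIV_chain2[OF has_real_derivative_pos_part_squared]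

text \<open>Products of functions of one coordinate each: their partial derivatives are explicit, and the
  product of functions supported in intervals is supported in a box.\<close>

definition tensor :: "('a::euclidean_space \<Rightarrow> real \<Rightarrow> real) \<Rightarrow> 'a \<Rightarrow> real" where
  "tensor h y = (\<Prod>i\<in>Basis. h i (inner y i))"

lemma has_derivative_tensor:
  fixes h :: "'a::euclidean_space \<Rightarrow> real \<Rightarrow> real"
  assumes "\<And>i t. i \<in> Basis \<Longrightarrow> (h i has_real_derivative h' i t) (at t)"
  shows "(tensor h has_derivative (\<lambda>v. \<Sum>i\<in>Basis. h' i (inner y i) * inner v i *
      (\<Prod>j\<in>Basis - {i}. h j (inner y j)))) (at y)"
  unfolding tensor_def
proof (rule has_derivative_prod)
  fix i :: 'a assume i: "i \<in> Basis"
  have "((\<lambda>y. inner y i) has_derivative (\<lambda>v. inner v i)) (at y)"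
    by (intro derivative_eq_intros) auto
  from has_derivative_compose[OF this, of "h i" "(*) (h' i (inner y i))"]
  show "((\<lambda>y. h i (inner y i)) has_derivative (\<lambda>v. h' i (inner y i) * inner v i)) (at y)"
    using assms[OF i] by (simp add: has_field_derivative_def)
qed

lemma frechet_derivative_tensor:
  fixes h :: "'a::euclidean_space \<Rightarrow> real \<Rightarrow> real"
  assumes "\<And>i t. i \<in> Basis \<Longrightarrow> (h i has_real_derivative h' i t) (at t)" and e: "e \<in> Basis"
  shows "frechet_derivative (tensor h) (at y) e
    = h' e (inner y e) * (\<Prod>j\<in>Basis - {e}. h j (inner y j))"
proof -
  have "frechet_derivative (tensor h) (at y) e
      = (\<Sum>i\<in>Basis. h' i (inner y i) * inner e i * (\<Prod>j\<in>Basis - {i}. h j (inner y j)))"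
    using fun_cong[OF frechet_derivative_at[OF has_derivative_tensor[of h h' y]], of e] assms(1) by simp
  also have "\<dots> = (\<Sum>i\<in>Basis. if i = e then h' i (inner y i) * (\<Prod>j\<in>Basis - {i}. h j (inner y j)) else 0)"
    using e by (intro sum.cong) (auto simp: inner_Basis)
  finally show ?thesis using e by simp
qed

lemma tensor_outside_box:
  assumes "\<And>i t. i \<in> Basis \<Longrightarrow> t \<notin> {inner a i..inner b i} \<Longrightarrow> h i t = 0" "y \<notin> cbox a b"
  shows "tensor h y = 0"
proof -
  obtain i where i: "i \<in> Basis" "inner y i \<notin> {inner a i..inner b i}"
    using assms(2) by (auto simp: mem_box)
  then have "h i (inner y i) = 0" using assms(1) by blast
  then show ?thesis using i(1) unfolding tensor_def by (intro prod_zero) auto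
qed

lemma test_function_tensor:
  fixes h :: "'a::euclidean_space \<Rightarrow> real \<Rightarrow> real"
  assumes deriv: "\<And>i t. i \<in> Basis \<Longrightarrow> (h i has_real_derivative h' i t) (at t)"
    and cont: "\<And>i. i \<in> Basis \<Longrightarrow> continuous_on UNIV (h' i)"
    and zero: "\<And>i t. i \<in> Basis \<Longrightarrow> t \<notin> {inner a i..inner b i} \<Longrightarrow> h i t = 0"
    and sub: "cbox a b \<subseteq> U"
  shows "test_function U (tensor h)"
proof -
  have supp: "closure {x. tensor h x \<noteq> 0} \<subseteq> cbox a b"
    using tensor_outside_box[of a b h] zero by (intro closure_minimal) (auto simp: closed_cbox)
  have h_cont: "continuous_on UNIV (h i)" if "i \<in> Basis" for i
    using deriv[OF that] by (meson DERIV_isCont continuous_at_imp_continuous_on)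
  have comp: "continuous_on UNIV (\<lambda>y. k (inner y i))" if "continuous_on UNIV k" for k :: "real \<Rightarrow> real" and i :: 'a
    by (rule continuous_on_compose2[OF that, of UNIV "\<lambda>y. inner y i"]) (auto intro!: continuous_intros)
  have "continuous_on UNIV (\<lambda>x. frechet_derivative (tensor h) (at x) e)" if e: "e \<in> Basis" for e
  proof -
    have D: "frechet_derivative (tensor h) (at x) e
        = h' e (inner x e) * (\<Prod>j\<in>Basis - {e}. h j (inner x j))" for x
      by (rule frechet_derivative_tensor) (use deriv e in auto)
    show ?thesis unfolding D using e by (intro continuous_intros comp cont h_cont) auto
  qed
  moreover have "tensor h differentiable (at x)" for x
    using has_derivative_tensor[of h h' x] deriv unfolding differentiable_def by blast
  moreover have "compact (closure {x. tensor h x \<noteq> 0})"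
    using compact_Int_closed[OF compact_cbox closed_closure, of a b "{x. tensor h x \<noteq> 0}"] supp
    by (simp add: Int_absorb1)
  ultimately show ?thesis
    unfolding test_function_def
    using supp sub by blast
qed

text \<open>Squares of positive parts are continuously differentiable, and test functions are required to be no
  smoother than that.\<close>

definition bump :: "real \<Rightarrow> real \<Rightarrow> real \<Rightarrow> real" where
  "bump a b t = (max 0 (t - a))\<^sup>2 * (max 0 (b - t))\<^sup>2"

definition bump_deriv :: "real \<Rightarrow> real \<Rightarrow> real \<Rightarrow> real" where
  "bump_deriv a b t = 2 * max 0 (t - a) * (max 0 (b - t))\<^sup>2 - 2 * max 0 (b - t) * (max 0 (t - a))\<^sup>2"

lemma bump_nonneg: "0 \<le> bump a b t"
  by (simp add: bump_def)

lemma bump_pos_iff: "0 < bump a b t \<longleftrightarrow> a < t \<and> t < b"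
  by (auto simp: bump_def zero_less_mult_iff max_def)

lemma bump_zero: "\<not> (a < t \<and> t < b) \<Longrightarrow> bump a b t = 0"
  using bump_pos_iff[of a b t] bump_nonneg[of a b t] by linarith

lemma has_real_derivative_bump: "(bump a b has_real_derivative bump_deriv a b t) (at t)"
  unfolding bump_def[abs_def] bump_deriv_def
  by (rule derivative_eq_intros derivative_pos_part_squared refl)+ (simp add: algebra_simps)

lemma continuous_bump_deriv: "continuous_on S (bump_deriv a b)"
  unfolding bump_deriv_def[abs_def] by (intro continuous_intros)

text \<open>Test functions between \<open>0\<close> and \<open>1\<close> that tend to the indicator function of an open interval, all of
  them vanishing outside that interval.\<close>

definition plateau :: "nat \<Rightarrow> real \<Rightarrow> real \<Rightarrow> real \<Rightarrow> real" where
  "plateau n a b t = n * bump a b t / (1 + n * bump a b t)"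

lemma plateau_bounds: "0 \<le> plateau n a b t" "plateau n a b t \<le> 1"
  using bump_nonneg[of a b t] by (auto simp: plateau_def divide_le_eq_1 add_pos_nonneg)

lemma plateau_tendsto: "(\<lambda>n. plateau n a b t) \<longlonglongrightarrow> (if a < t \<and> t < b then 1 else 0)"
proof (cases "a < t \<and> t < b")
  case True
  define q where "q = bump a b t"
  have q: "0 < q" using True by (simp add: q_def bump_pos_iff)
  have "(\<lambda>n. real n * q / (1 + real n * q)) \<longlonglongrightarrow> 1" using q by real_asymp
  then show ?thesis using True by (simp add: plateau_def q_def)
next
  case False
  then have "plateau n a b t = 0" for n by (simp add: plateau_def bump_zero)
  then show ?thesis by (subst if_not_P[OF False]) simp
qed

lemma has_real_derivative_plateau:
  "(plateau n a b has_real_derivative n * bump_deriv a b t / (1 + n * bump a b t)\<^sup>2) (at t)"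
proof -
  have "1 + n * bump a b t \<noteq> 0"
    using bump_nonneg[of a b t] by (smt (verit) mult_nonneg_nonneg of_nat_0_le_iff)
  then show ?thesis
    unfolding plateau_def[abs_def]
    by (auto intro!: derivative_eq_intros has_real_derivative_bump simp: power2_eq_square field_simps)
qed

lemma test_function_plateau:
  fixes a b :: "'a::euclidean_space"
  assumes "cbox a b \<subseteq> U"
  shows "test_function U (tensor (\<lambda>i. plateau n (inner a i) (inner b i)))"
proof (rule test_function_tensor[OF has_real_derivative_plateau _ _ assms])
  fix i :: 'a
  have "1 + n * bump (inner a i) (inner b i) t \<noteq> 0" for t
    using bump_nonneg[of "inner a i" "inner b i" t] by (smt (verit) mult_nonneg_nonneg of_nat_0_le_iff)
  moreover have "continuous_on UNIV (bump (inner a i) (inner b i))"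
    using has_real_derivative_bump by (meson DERIV_isCont continuous_at_imp_continuous_on)
  ultimately show "continuous_on UNIV (\<lambda>t. n * bump_deriv (inner a i) (inner b i) t /
      (1 + n * bump (inner a i) (inner b i) t)\<^sup>2)"
    by (intro continuous_intros continuous_bump_deriv) auto
  fix t assume "t \<notin> {inner a i..inner b i}"
  then have "bump (inner a i) (inner b i) t = 0" by (intro bump_zero) auto
  then show "plateau n (inner a i) (inner b i) t = 0" by (simp add: plateau_def)
qed

lemma tensor_plateau_tendsto:
  fixes a b :: "'a::euclidean_space"
  shows "(\<lambda>n. tensor (\<lambda>i. plateau n (inner a i) (inner b i)) y) \<longlonglongrightarrow> indicator (box a b) y"
proof -
  have "(\<lambda>n. tensor (\<lambda>i. plateau n (inner a i) (inner b i)) y) \<longlonglongrightarrow>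
      (\<Prod>i\<in>Basis. if inner a i < inner y i \<and> inner y i < inner b i then 1 else 0)"
    unfolding tensor_def by (intro tendsto_prod plateau_tendsto)
  also have "(\<Prod>i\<in>Basis. if inner a i < inner y i \<and> inner y i < inner b i then 1 else 0)
      = indicat_real (box a b) y"
  proof (cases "y \<in> box a b")
    case False
    then obtain i where "i \<in> Basis" "\<not> (inner a i < inner y i \<and> inner y i < inner b i)"
      by (auto simp: mem_box)
    then show ?thesis using False by (auto intro!: prod_zero)
  qed (auto simp: mem_box)
  finally show ?thesis .
qed

lemma tensor_plateau_bound:
  "\<bar>tensor (\<lambda>i. plateau n (inner a i) (inner b i)) y\<bar> \<le> 1"
proof -
  have "0 \<le> tensor (\<lambda>i. plateau n (inner a i) (inner b i)) y"
    unfolding tensor_def by (intro prod_nonneg ballI plateau_bounds)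
  moreover have "tensor (\<lambda>i. plateau n (inner a i) (inner b i)) y \<le> 1"
    unfolding tensor_def by (intro prod_le_1 conjI plateau_bounds)
  ultimately show ?thesis by simp
qed

lemma continuous_on_test_function: "test_function U \<psi> \<Longrightarrow> continuous_on S \<psi>"
  by (meson test_function_def differentiable_imp_continuous_within continuous_at_imp_continuous_on)

section \<open>The fundamental lemma of the calculus of variations\<close>

text \<open>The boxes form an intersection-stable generator of the Borel sets, so the vanishing of the integral
  extends from boxes to all Borel subsets of one fixed box.\<close>

lemma AE_eq_0_if_box_integrals_0:
  fixes G :: "'a::euclidean_space \<Rightarrow> real"
  assumes G: "integrable lborel G"
    and zero: "\<And>a b. cbox a b \<subseteq> U \<Longrightarrow> (\<integral>x. indicator (box a b) x * G x \<partial>lborel) = 0"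
    and sub: "cbox c d \<subseteq> U"
  shows "AE x in lborel. x \<in> box c d \<longrightarrow> G x = 0"
proof -
  define g where "g x = indicator (box c d) x * G x" for x
  have g: "integrable lborel g"
    unfolding g_def using integrable_mult_indicator[OF _ G, of "box c d"] by simp
  have si: "set_integrable lborel A g" if "A \<in> sets borel" for A
    unfolding set_integrable_def using integrable_mult_indicator[OF _ g, of A] that by simp
  have all: "(LINT x:A|lborel. g x) = 0" if "A \<in> sets borel" for A
  proof -
    have "Int_stable (range (\<lambda>(a, b). box a b :: 'a set))"
      by (auto simp: Int_stable_def box_Int_box)
    moreover have "range (\<lambda>(a, b). box a b :: 'a set) \<subseteq> Pow UNIV" by simp
    moreover have "A \<in> sigma_sets UNIV (range (\<lambda>(a, b). box a b :: 'a set))"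
      using that by (simp add: borel_eq_box)
    ultimately show ?thesis
    proof (induction A rule: sigma_sets_induct_disjoint)
      case (basic A)
      then obtain a b where A: "A = box a b" by auto
      define a' where "a' = (\<Sum>i\<in>Basis. max (inner a i) (inner c i) *\<^sub>R i)"
      define b' where "b' = (\<Sum>i\<in>Basis. min (inner b i) (inner d i) *\<^sub>R i)"
      have "box a b \<inter> box c d = box a' b'" by (simp add: box_Int_box a'_def b'_def)
      then have "indicator A x * g x = indicator (box a' b') x * G x" for x
        by (auto simp: A g_def indicator_def)
      moreover have "cbox a' b' \<subseteq> cbox c d" by (auto simp: a'_def b'_def mem_box)
      ultimately show ?case using zero[of a' b'] sub by (simp add: set_lebesgue_integral_def)
    next
      case (compl A)
      have A: "A \<in> sets borel" using compl.hyps by (simp add: borel_eq_box)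
      have "(LINT x:UNIV - A|lborel. g x) = (\<integral>x. g x - indicator A x * g x \<partial>lborel)"
        unfolding set_lebesgue_integral_def by (intro Bochner_Integration.integral_cong) (auto simp: indicator_def)
      also have "\<dots> = (\<integral>x. g x \<partial>lborel) - (LINT x:A|lborel. g x)"
        using g si[OF A] unfolding set_lebesgue_integral_def set_integrable_def
        by (simp add: Bochner_Integration.integral_diff)
      also have "(\<integral>x. g x \<partial>lborel) = 0" unfolding g_def by (rule zero[OF sub])
      finally show ?case using compl by simp
    next
      case (union A)
      then have A: "A i \<in> sets borel" for i by (auto simp: borel_eq_box)
      have "(LINT x:(\<Union>i. A i)|lborel. g x) = (\<Sum>i. (LINT x:A i|lborel. g x))"
        using union.hyps A si by (intro lebesgue_integral_countable_add) (auto simp: disjoint_family_on_def)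
      then show ?case using union by simp
    qed (auto simp: set_lebesgue_integral_def)
  qed
  have "AE x in lborel. g x = 0"
    by (rule density_unique_real) (use g all in auto)
  then show ?thesis by eventually_elim (auto simp: g_def)
qed

text \<open>Testing with products of plateau functions and passing to the limit shows that the integral of \<open>h\<close>
  vanishes over every box whose closure lies in \<open>U\<close>. Since the uniqueness argument on boxes takes place
  on Borel sets, \<open>h\<close> is first replaced by a Borel function that agrees with it almost
  everywhere.\<close>

lemma fundamental_lemma_of_calculus_of_variations:
  fixes h :: "'a::euclidean_space \<Rightarrow> real"
  assumes \<Omega>: "open \<Omega>" and U: "open U" "U \<subseteq> \<Omega>"
    and h: "integrable (lebesgue_on \<Omega>) h"
    and zero: "\<And>\<psi>. test_function U \<psi> \<Longrightarrow> (\<integral>x. h x * \<psi> x \<partial>lebesgue_on \<Omega>) = 0"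
  shows "AE x in lebesgue_on \<Omega>. x \<in> U \<longrightarrow> h x = 0"
proof -
  have \<Omega>_sets: "\<Omega> \<inter> space lebesgue \<in> sets (lebesgue :: 'a measure)" using \<Omega> by auto
  define H where "H x = indicator \<Omega> x * h x" for x
  have H: "integrable lebesgue H"
    using h unfolding H_def integrable_restrict_space[OF \<Omega>_sets] by simp
  obtain G where G: "G \<in> borel_measurable lborel" "AE x in lborel. H x = G x"
    using completion_ex_borel_measurable_real[of H lborel] H by auto
  have HG: "AE x in lebesgue. H x = G x" using G(2) by (rule AE_completion)
  have G_leb: "G \<in> borel_measurable lebesgue" using G(1) by (rule measurable_completion)
  have "integrable lebesgue G"
    by (rule integrable_cong_AE_imp[OF H]) (use G_leb HG in auto)
  then have G_int: "integrable lborel G" using G(1) by (simp add: integrable_completion)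
  have box_zero: "(\<integral>x. indicator (box a b) x * G x \<partial>lborel) = 0" if "cbox a b \<subseteq> U" for a b
  proof -
    define \<psi> where "\<psi> n = tensor (\<lambda>i. plateau n (inner a i) (inner b i))" for n
    have \<psi>: "test_function U (\<psi> n)" for n
      unfolding \<psi>_def by (rule test_function_plateau[OF that])
    have \<psi>_meas: "\<psi> n \<in> borel_measurable borel" for n
      using continuous_on_test_function[OF \<psi>] by (rule borel_measurable_continuous_onI)
    have z: "(\<integral>x. \<psi> n x * G x \<partial>lborel) = 0" for n
    proof -
      have "0 = (\<integral>x. h x * \<psi> n x \<partial>lebesgue_on \<Omega>)" using zero[OF \<psi>] by simp
      also have "\<dots> = (\<integral>x. \<psi> n x * H x \<partial>lebesgue)"
        by (subst integral_restrict_space[OF \<Omega>_sets])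
          (auto simp: H_def indicator_def ac_simps intro!: Bochner_Integration.integral_cong)
      also have "\<dots> = (\<integral>x. \<psi> n x * G x \<partial>lebesgue)"
      proof (rule integral_cong_AE)
        show "AE x in lebesgue. \<psi> n x * H x = \<psi> n x * G x" using HG by eventually_elim simp
        have "\<psi> n \<in> borel_measurable lebesgue" using \<psi>_meas by (simp add: measurable_completion)
        moreover note G_leb
        ultimately show "(\<lambda>x. \<psi> n x * H x) \<in> borel_measurable lebesgue"
          "(\<lambda>x. \<psi> n x * G x) \<in> borel_measurable lebesgue" using H by auto
      qed
      also have "\<dots> = (\<integral>x. \<psi> n x * G x \<partial>lborel)"
        using \<psi>_meas G(1) by (intro integral_completion) auto
      finally show ?thesis by simp
    qed
    have "(\<lambda>n. \<integral>x. \<psi> n x * G x \<partial>lborel) \<longlonglongrightarrow> (\<integral>x. indicator (box a b) x * G x \<partial>lborel)"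
    proof (rule integral_dominated_convergence)
      show "integrable lborel (\<lambda>x. \<bar>G x\<bar>)" using G_int by simp
      show "AE x in lborel. (\<lambda>n. \<psi> n x * G x) \<longlonglongrightarrow> indicator (box a b) x * G x"
        unfolding \<psi>_def by (intro AE_I2 tendsto_intros tensor_plateau_tendsto)
      show "AE x in lborel. norm (\<psi> n x * G x) \<le> \<bar>G x\<bar>" for n
      proof (rule AE_I2)
        fix x
        have "\<bar>\<psi> n x\<bar> \<le> 1" unfolding \<psi>_def by (rule tensor_plateau_bound)
        then show "norm (\<psi> n x * G x) \<le> \<bar>G x\<bar>" by (simp add: abs_mult mult_left_le_one_le)
      qed
    qed (use \<psi>_meas G(1) in auto)
    then show ?thesis unfolding z by (simp add: LIMSEQ_const_iff)
  qed
  define F where "F = {box a b | a b. cbox a b \<subseteq> U}"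
  obtain F' where F': "F' \<subseteq> F" "countable F'" "\<Union>F' = \<Union>F"
    by (rule Lindelof[of F]) (auto simp: F_def)
  have "\<Union>F = U"
  proof
    show "\<Union>F \<subseteq> U" using box_subset_cbox by (fastforce simp: F_def)
    show "U \<subseteq> \<Union>F"
    proof
      fix x assume "x \<in> U"
      then obtain a b where "x \<in> box a b" "cbox a b \<subseteq> U"
        using open_contains_cbox[of U] U(1) by metis
      then show "x \<in> \<Union>F" by (auto simp: F_def)
    qed
  qed
  have "AE x in lborel. x \<in> X \<longrightarrow> G x = 0" if X: "X \<in> F'" for X
  proof -
    obtain a b where "X = box a b" "cbox a b \<subseteq> U" using X F'(1) unfolding F_def by blast
    then show ?thesis using AE_eq_0_if_box_integrals_0[OF G_int box_zero] by simp
  qed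
  then have "AE x in lborel. \<forall>X\<in>F'. x \<in> X \<longrightarrow> G x = 0"
    using AE_ball_countable'[OF _ F'(2), where M = lborel and P = "\<lambda>X x. x \<in> X \<longrightarrow> G x = 0"] by blast
  then have "AE x in lborel. x \<in> U \<longrightarrow> h x = 0"
    using G(2)
  proof eventually_elim
    case (elim x)
    then show ?case using F'(3) \<open>\<Union>F = U\<close> U(2) by (auto simp: H_def)
  qed
  then have "AE x in lebesgue. x \<in> U \<longrightarrow> h x = 0" by (rule AE_completion)
  then show ?thesis
    unfolding AE_restrict_space_iff[OF \<Omega>_sets] by eventually_elim simp
qed

section \<open>Square integrable functions and weak gradients\<close>

lemma finite_measure_lebesgue_on_bounded:
  assumes "open \<Omega>" "bounded \<Omega>"
  shows "finite_measure (lebesgue_on \<Omega>)"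
  using assms by (intro finite_measure_lebesgue_on lmeasurable_open)

lemma L2_integrable_mult:
  fixes f g :: "'a::euclidean_space \<Rightarrow> real"
  assumes "L2 \<Omega> f" "L2 \<Omega> g"
  shows "integrable (lebesgue_on \<Omega>) (\<lambda>x. f x * g x)"
proof (rule Bochner_Integration.integrable_bound)
  show "integrable (lebesgue_on \<Omega>) (\<lambda>x. (norm (f x))\<^sup>2 + (norm (g x))\<^sup>2)"
    using assms by (auto simp: L2_def)
  show "AE x in lebesgue_on \<Omega>. norm (f x * g x) \<le> norm ((norm (f x))\<^sup>2 + (norm (g x))\<^sup>2)"
  proof (rule AE_I2)
    fix x
    have "2 * (\<bar>f x\<bar> * \<bar>g x\<bar>) \<le> (f x)\<^sup>2 + (g x)\<^sup>2"
      using sum_squares_bound[of "\<bar>f x\<bar>" "\<bar>g x\<bar>"] by simp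
    moreover have "0 \<le> (f x)\<^sup>2 + (g x)\<^sup>2" by simp
    ultimately have "\<bar>f x\<bar> * \<bar>g x\<bar> \<le> (f x)\<^sup>2 + (g x)\<^sup>2" by linarith
    then show "norm (f x * g x) \<le> norm ((norm (f x))\<^sup>2 + (norm (g x))\<^sup>2)"
      by (simp add: abs_mult)
  qed
qed (use assms in \<open>auto simp: L2_def\<close>)

lemma L2_const:
  assumes "open \<Omega>" "bounded \<Omega>"
  shows "L2 \<Omega> (\<lambda>_. c)"
proof -
  interpret finite_measure "lebesgue_on \<Omega>"
    by (rule finite_measure_lebesgue_on_bounded[OF assms])
  show ?thesis by (simp add: L2_def)
qed

lemma L2_integrable:
  fixes f :: "'a::euclidean_space \<Rightarrow> real"
  assumes "open \<Omega>" "bounded \<Omega>" "L2 \<Omega> f"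
  shows "integrable (lebesgue_on \<Omega>) f"
  using L2_integrable_mult[OF assms(3) L2_const[OF assms(1,2), of 1]] by simp

lemma L2_scaleR: "L2 \<Omega> f \<Longrightarrow> L2 \<Omega> (\<lambda>x. c *\<^sub>R f x)"
  by (auto simp: L2_def power_mult_distrib)

lemma L2_add:
  fixes f g :: "'a::euclidean_space \<Rightarrow> 'b::euclidean_space"
  assumes "L2 \<Omega> f" "L2 \<Omega> g"
  shows "L2 \<Omega> (\<lambda>x. f x + g x)"
  unfolding L2_def
proof
  show "(\<lambda>x. f x + g x) \<in> borel_measurable (lebesgue_on \<Omega>)" using assms by (auto simp: L2_def)
  show "integrable (lebesgue_on \<Omega>) (\<lambda>x. (norm (f x + g x))\<^sup>2)"
  proof (rule Bochner_Integration.integrable_bound)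
    show "integrable (lebesgue_on \<Omega>) (\<lambda>x. 2 * (norm (f x))\<^sup>2 + 2 * (norm (g x))\<^sup>2)"
      using assms by (auto simp: L2_def)
    show "AE x in lebesgue_on \<Omega>. norm ((norm (f x + g x))\<^sup>2) \<le> norm (2 * (norm (f x))\<^sup>2 + 2 * (norm (g x))\<^sup>2)"
    proof (rule AE_I2)
      fix x
      have "(norm (f x + g x))\<^sup>2 \<le> (norm (f x) + norm (g x))\<^sup>2"
        by (intro power_mono norm_triangle_ineq) auto
      also have "\<dots> \<le> 2 * (norm (f x))\<^sup>2 + 2 * (norm (g x))\<^sup>2"
        using sum_squares_bound[of "norm (f x)" "norm (g x)"] by (simp add: power2_sum)
      finally show "norm ((norm (f x + g x))\<^sup>2) \<le> norm (2 * (norm (f x))\<^sup>2 + 2 * (norm (g x))\<^sup>2)"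
        by simp
    qed
  qed (use assms in \<open>auto simp: L2_def\<close>)
qed

lemma L2_inner:
  fixes g :: "'a::euclidean_space \<Rightarrow> 'b::euclidean_space"
  assumes "L2 \<Omega> g"
  shows "L2 \<Omega> (\<lambda>x. inner (g x) e)"
  unfolding L2_def
proof
  show "(\<lambda>x. inner (g x) e) \<in> borel_measurable (lebesgue_on \<Omega>)" using assms by (auto simp: L2_def)
  show "integrable (lebesgue_on \<Omega>) (\<lambda>x. (norm (inner (g x) e))\<^sup>2)"
  proof (rule Bochner_Integration.integrable_bound)
    show "integrable (lebesgue_on \<Omega>) (\<lambda>x. (norm e)\<^sup>2 * (norm (g x))\<^sup>2)"
      using assms by (auto simp: L2_def)
    show "AE x in lebesgue_on \<Omega>. norm ((norm (inner (g x) e))\<^sup>2) \<le> norm ((norm e)\<^sup>2 * (norm (g x))\<^sup>2)"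
    proof (rule AE_I2)
      fix x
      have "\<bar>inner (g x) e\<bar>\<^sup>2 \<le> (norm (g x) * norm e)\<^sup>2"
        by (intro power_mono Cauchy_Schwarz_ineq2) auto
      then show "norm ((norm (inner (g x) e))\<^sup>2) \<le> norm ((norm e)\<^sup>2 * (norm (g x))\<^sup>2)"
        by (simp add: power_mult_distrib ac_simps)
    qed
  qed (use assms in \<open>auto simp: L2_def\<close>)
qed

lemma frechet_derivative_eq_0_off_support:
  fixes \<psi> :: "'a::euclidean_space \<Rightarrow> real"
  assumes "x \<notin> closure {x. \<psi> x \<noteq> 0}"
  shows "frechet_derivative \<psi> (at x) = (\<lambda>_. 0)"
proof -
  have "((\<lambda>_. 0 :: real) has_derivative (\<lambda>_. 0)) (at x)" by simp
  then have "(\<psi> has_derivative (\<lambda>_. 0)) (at x)"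
    by (rule has_derivative_transform_within_open[of _ _ _ _ "- closure {x. \<psi> x \<noteq> 0}"])
      (use assms closure_subset in force)+
  then show ?thesis using frechet_derivative_at by metis
qed

lemma L2_continuous_compact_support:
  fixes k :: "'a::euclidean_space \<Rightarrow> real"
  assumes \<Omega>: "open \<Omega>" "bounded \<Omega>" and k: "continuous_on UNIV k" and K: "compact K" "\<And>x. x \<notin> K \<Longrightarrow> k x = 0"
  shows "L2 \<Omega> k"
  unfolding L2_def
proof
  have m: "k \<in> borel_measurable borel" using k by (rule borel_measurable_continuous_onI)
  show meas: "k \<in> borel_measurable (lebesgue_on \<Omega>)"
    by (intro measurable_restrict_space1 measurable_completion) (use m in simp)
  obtain B where B: "\<And>x. x \<in> K \<Longrightarrow> \<bar>k x\<bar> \<le> B"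
    using compact_imp_bounded[OF compact_continuous_image[OF continuous_on_subset[OF k] K(1)]]
    by (auto simp: bounded_iff)
  have bound: "(norm (k x))\<^sup>2 \<le> B\<^sup>2" for x
  proof (cases "x \<in> K")
    case True
    then show ?thesis using B[OF True] by (simp add: abs_le_square_iff[symmetric])
  qed (simp add: K(2))
  interpret finite_measure "lebesgue_on \<Omega>"
    by (rule finite_measure_lebesgue_on_bounded[OF \<Omega>])
  show "integrable (lebesgue_on \<Omega>) (\<lambda>x. (norm (k x))\<^sup>2)"
    by (rule integrable_const_bound[of _ "B\<^sup>2"]) (use bound meas in auto)
qed

lemma L2_test_function:
  assumes \<Omega>: "open \<Omega>" "bounded \<Omega>" and \<psi>: "test_function U \<psi>"
  shows "L2 \<Omega> \<psi>" "\<And>e. e \<in> Basis \<Longrightarrow> L2 \<Omega> (\<lambda>x. frechet_derivative \<psi> (at x) e)"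
proof -
  have K: "compact (closure {x. \<psi> x \<noteq> 0})" using \<psi> by (simp add: test_function_def)
  show "L2 \<Omega> \<psi>"
    by (rule L2_continuous_compact_support[OF \<Omega> continuous_on_test_function[OF \<psi>] K])
      (use closure_subset in force)
  show "L2 \<Omega> (\<lambda>x. frechet_derivative \<psi> (at x) e)" if "e \<in> Basis" for e
    by (rule L2_continuous_compact_support[OF \<Omega> _ K])
      (use \<psi> that in \<open>auto simp: test_function_def frechet_derivative_eq_0_off_support\<close>)
qed

text \<open>Weak derivatives are local: a test function supported in \<open>U\<close> has derivatives that vanish where
  \<open>f\<close> does not.\<close>

lemma weak_gradient_eq_0_where_function_eq_0:
  fixes f :: "'a::euclidean_space \<Rightarrow> real"
  assumes \<Omega>: "open \<Omega>" "bounded \<Omega>" and g: "is_weak_gradient \<Omega> f g"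
    and U: "open U" "U \<subseteq> \<Omega>" and f: "\<And>x. x \<in> U \<Longrightarrow> f x = 0"
  shows "AE x in lebesgue_on \<Omega>. x \<in> U \<longrightarrow> g x = 0"
proof -
  have "AE x in lebesgue_on \<Omega>. x \<in> U \<longrightarrow> inner (g x) e = 0" if e: "e \<in> Basis" for e
  proof (rule fundamental_lemma_of_calculus_of_variations[OF \<Omega>(1) U])
    show "integrable (lebesgue_on \<Omega>) (\<lambda>x. inner (g x) e)"
      using g by (intro L2_integrable[OF \<Omega>] L2_inner) (simp add: is_weak_gradient_def)
    fix \<psi> :: "'a \<Rightarrow> real" assume \<psi>: "test_function U \<psi>"
    have z: "f x * frechet_derivative \<psi> (at x) e = 0" for x
    proof (cases "x \<in> U")
      case False
      then have "x \<notin> closure {x. \<psi> x \<noteq> 0}" using \<psi> by (auto simp: test_function_def)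
      then show ?thesis by (simp add: frechet_derivative_eq_0_off_support)
    qed (simp add: f)
    have "test_function \<Omega> \<psi>" using \<psi> U(2) by (auto simp: test_function_def)
    then have "(\<integral>x. f x * frechet_derivative \<psi> (at x) e \<partial>lebesgue_on \<Omega>)
        = - (\<integral>x. inner (g x) e * \<psi> x \<partial>lebesgue_on \<Omega>)"
      using g e by (simp add: is_weak_gradient_def)
    then show "(\<integral>x. inner (g x) e * \<psi> x \<partial>lebesgue_on \<Omega>) = 0" unfolding z by simp
  qed
  then have "AE x in lebesgue_on \<Omega>. \<forall>e\<in>Basis. x \<in> U \<longrightarrow> inner (g x) e = 0"
    using AE_ball_countable'[where I = Basis and M = "lebesgue_on \<Omega>" and
        P = "\<lambda>e x. x \<in> U \<longrightarrow> inner (g x) e = 0", OF _ countable_finite[OF finite_Basis]] by blast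
  then show ?thesis
  proof eventually_elim
    case (elim x)
    then show ?case by (auto intro: euclidean_eqI)
  qed
qed

lemma is_weak_gradient_zero: "is_weak_gradient \<Omega> (\<lambda>_. 0) (\<lambda>_. 0)"
  by (simp add: is_weak_gradient_def L2_def)

text \<open>The integrals may be split because all products of the functions with a test function and its
  derivatives are integrable.\<close>

lemma is_weak_gradient_scaled_add:
  fixes f f' :: "'a::euclidean_space \<Rightarrow> real"
  assumes \<Omega>: "open \<Omega>" "bounded \<Omega>"
    and f: "L2 \<Omega> f" "is_weak_gradient \<Omega> f g" and f': "L2 \<Omega> f'" "is_weak_gradient \<Omega> f' g'"
  shows "is_weak_gradient \<Omega> (\<lambda>x. c * f x + f' x) (\<lambda>x. c *\<^sub>R g x + g' x)"
  unfolding is_weak_gradient_def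
proof (intro conjI allI impI ballI)
  have g: "L2 \<Omega> g" "L2 \<Omega> g'" using f f' by (auto simp: is_weak_gradient_def)
  then show "L2 \<Omega> (\<lambda>x. c *\<^sub>R g x + g' x)" by (intro L2_add L2_scaleR)
  fix \<psi> :: "'a \<Rightarrow> real" and e :: 'a assume \<psi>: "test_function \<Omega> \<psi>" and e: "e \<in> Basis"
  note L2_test = L2_test_function(1)[OF \<Omega> \<psi>] L2_test_function(2)[OF \<Omega> \<psi> e]
  let ?D = "\<lambda>x. frechet_derivative \<psi> (at x) e"
  have "(\<integral>x. (c * f x + f' x) * ?D x \<partial>lebesgue_on \<Omega>)
      = (\<integral>x. c * (f x * ?D x) + f' x * ?D x \<partial>lebesgue_on \<Omega>)"
    by (simp add: algebra_simps)
  also have "\<dots> = c * (\<integral>x. f x * ?D x \<partial>lebesgue_on \<Omega>) + (\<integral>x. f' x * ?D x \<partial>lebesgue_on \<Omega>)"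
    using L2_integrable_mult[OF f(1) L2_test(2)] L2_integrable_mult[OF f'(1) L2_test(2)] by simp
  also have "\<dots> = - (c * (\<integral>x. inner (g x) e * \<psi> x \<partial>lebesgue_on \<Omega>)
      + (\<integral>x. inner (g' x) e * \<psi> x \<partial>lebesgue_on \<Omega>))"
    using f f' \<psi> e by (simp add: is_weak_gradient_def)
  also have "\<dots> = - (\<integral>x. c * (inner (g x) e * \<psi> x) + inner (g' x) e * \<psi> x \<partial>lebesgue_on \<Omega>)"
    using L2_integrable_mult[OF L2_inner[OF g(1)] L2_test(1)] L2_integrable_mult[OF L2_inner[OF g(2)] L2_test(1)]
    by simp
  also have "\<dots> = - (\<integral>x. inner (c *\<^sub>R g x + g' x) e * \<psi> x \<partial>lebesgue_on \<Omega>)"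
    by (simp add: algebra_simps inner_add_left)
  finally show "(\<integral>x. (c * f x + f' x) * ?D x \<partial>lebesgue_on \<Omega>)
      = - (\<integral>x. inner (c *\<^sub>R g x + g' x) e * \<psi> x \<partial>lebesgue_on \<Omega>)" .
qed

lemma H1_lin_comb:
  fixes f :: "'i \<Rightarrow> 'a::euclidean_space \<Rightarrow> real"
  assumes \<Omega>: "open \<Omega>" "bounded \<Omega>" and "finite I" "\<And>k. k \<in> I \<Longrightarrow> f k \<in> H1 \<Omega>"
  shows "(\<lambda>x. \<Sum>k\<in>I. c k * f k x) \<in> H1 \<Omega>"
  using assms(3,4)
proof (induction I rule: finite_induct)
  case empty
  then show ?case using is_weak_gradient_zero[of \<Omega>] by (auto simp: H1_def L2_def)
next
  case (insert k I)
  then have "f k \<in> H1 \<Omega>" "(\<lambda>x. \<Sum>k\<in>I. c k * f k x) \<in> H1 \<Omega>" by auto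
  then obtain g g' where *: "L2 \<Omega> (f k)" "is_weak_gradient \<Omega> (f k) g"
      "L2 \<Omega> (\<lambda>x. \<Sum>k\<in>I. c k * f k x)" "is_weak_gradient \<Omega> (\<lambda>x. \<Sum>k\<in>I. c k * f k x) g'"
    unfolding H1_def by blast
  have "L2 \<Omega> (\<lambda>x. c k * f k x + (\<Sum>k\<in>I. c k * f k x))"
    using L2_add[OF L2_scaleR[OF *(1), of "c k"] *(3)] by simp
  moreover have "is_weak_gradient \<Omega> (\<lambda>x. c k * f k x + (\<Sum>k\<in>I. c k * f k x)) (\<lambda>x. c k *\<^sub>R g x + g' x)"
    by (rule is_weak_gradient_scaled_add[OF \<Omega> *])
  ultimately show ?case using insert by (auto simp: H1_def)
qed

lemma is_weak_gradient_weak_gradient: "f \<in> H1 \<Omega> \<Longrightarrow> is_weak_gradient \<Omega> f (weak_gradient \<Omega> f)"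
  using someI_ex[of "is_weak_gradient \<Omega> f"] by (auto simp: H1_def weak_gradient_def)

section \<open>Functions with a vanishing weak derivative in one direction\<close>

text \<open>\<open>tent\<close> is the hat function on \<open>[-1, 1]\<close>, and \<open>smooth_step\<close>, the second difference of the squared
  positive part, is an antiderivative of \<open>2 tent\<close> that is constant on both sides of \<open>[-1, 1]\<close>.\<close>

definition tent :: "real \<Rightarrow> real" where
  "tent t = max 0 (t + 1) - 2 * max 0 t + max 0 (t - 1)"

definition smooth_step :: "real \<Rightarrow> real" where
  "smooth_step t = (max 0 (t + 1))\<^sup>2 - 2 * (max 0 t)\<^sup>2 + (max 0 (t - 1))\<^sup>2"

lemma tent_nonneg: "0 \<le> tent t" and tent_pos: "\<bar>t\<bar> < 1 \<Longrightarrow> 0 < tent t" and tent_zero: "1 \<le> \<bar>t\<bar> \<Longrightarrow> tent t = 0"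
  by (auto simp: tent_def max_def abs_if split: if_splits)

lemma smooth_step_left: "t \<le> -1 \<Longrightarrow> smooth_step t = 0"
  by (simp add: smooth_step_def)

lemma smooth_step_right: "1 \<le> t \<Longrightarrow> smooth_step t = 2"
  by (simp add: smooth_step_def power2_eq_square algebra_simps)

lemma has_real_derivative_smooth_step: "(smooth_step has_real_derivative 2 * tent t) (at t)"
  unfolding smooth_step_def[abs_def] tent_def
  by (rule derivative_eq_intros derivative_pos_part_squared refl)+ (simp add: algebra_simps)

lemma continuous_tent: "continuous_on S tent"
  unfolding tent_def[abs_def] by (intro continuous_intros)

text \<open>Let \<open>\<eta>\<close> be a nonnegative bump at \<open>y\<close>. The difference of \<open>\<eta>\<close> and its translate by \<open>\<rho> e\<close> is the
  derivative in the direction \<open>e\<close> of a test function, so by translation invariance the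
  integral of \<open>(f z - f (z + \<rho> e)) \<eta> z\<close> vanishes. If the continuous factor
  \<open>g z = f z - f (z + \<rho> e)\<close> were nonzero at \<open>y\<close>, it would have one sign on the support of a
  narrow bump and the integral would not vanish.\<close>

lemma locally_constant_in_direction:
  fixes f :: "'a::euclidean_space \<Rightarrow> real"
  assumes \<Omega>: "open \<Omega>" and f: "continuous_on \<Omega> f" and e: "e \<in> Basis"
    and zero: "\<And>\<psi>. test_function \<Omega> \<psi> \<Longrightarrow>
      (\<integral>x. f x * frechet_derivative \<psi> (at x) e \<partial>lebesgue_on \<Omega>) = 0"
    and y: "y \<in> \<Omega>"
  shows "\<exists>\<rho>>0. y + \<rho> *\<^sub>R e \<in> \<Omega> \<and> f (y + \<rho> *\<^sub>R e) = f y"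
proof -
  obtain r where r: "r > 0" "cball y r \<subseteq> \<Omega>" using \<Omega> y open_contains_cball by blast
  \<comment> \<open>Small enough for the box around \<open>y\<close> with half edges \<open>2 \<rho>\<close> to lie in the ball: it contains the
      bump, whose radius is at most \<open>\<rho>\<close>, and its translate.\<close>
  define \<rho> where "\<rho> = r / (3 * DIM('a))"
  have \<rho>: "\<rho> > 0" using r by (simp add: \<rho>_def)
  have near: "z \<in> \<Omega>" if "\<And>i. i \<in> Basis \<Longrightarrow> \<bar>inner z i - inner y i\<bar> \<le> 2 * \<rho>" for z
  proof -
    have "norm (z - y) \<le> (\<Sum>i\<in>Basis. \<bar>inner (z - y) i\<bar>)" by (rule norm_le_l1)
    also have "\<dots> \<le> (\<Sum>i\<in>(Basis :: 'a set). 2 * \<rho>)"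
      using that by (intro sum_mono) (simp add: inner_diff_left)
    also have "\<dots> \<le> r" using r by (simp add: \<rho>_def)
    finally show ?thesis using r(2) by (auto simp: dist_norm norm_minus_commute)
  qed
  define g where "g z = f z - f (z + \<rho> *\<^sub>R e)" for z
  have ye: "y + \<rho> *\<^sub>R e \<in> \<Omega>" using \<rho> e by (intro near) (auto simp: inner_add_left inner_Basis)
  have "g y = 0"
  proof (rule ccontr)
    assume gy: "g y \<noteq> 0"
    have "isCont f y" using f \<Omega> y continuous_on_eq_continuous_at by blast
    moreover have "isCont (\<lambda>z. f (z + \<rho> *\<^sub>R e)) y"
    proof -
      have "isCont f (y + \<rho> *\<^sub>R e)" using f \<Omega> ye continuous_on_eq_continuous_at by blast
      then show ?thesis by (intro isCont_o2[of y "\<lambda>z. z + \<rho> *\<^sub>R e" f]) auto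
    qed
    ultimately have cont_g: "isCont (\<lambda>z. g y * g z) y" unfolding g_def by (intro continuous_intros)
    have gyy: "0 < g y * g y" using gy by (simp add: zero_less_mult_iff) linarith
    have "\<forall>\<^sub>F z in at y. 0 < g y * g z"
      using order_tendstoD(1)[OF isContD[OF cont_g] gyy] .
    then obtain \<epsilon> where \<epsilon>: "\<epsilon> > 0" "\<And>z. dist z y < \<epsilon> \<Longrightarrow> 0 < g y * g z"
      using gyy unfolding eventually_at by (metis UNIV_I)
    define \<delta> where "\<delta> = min \<rho> (\<epsilon> / (2 * DIM('a)))"
    have \<delta>: "0 < \<delta>" "\<delta> \<le> \<rho>" using \<rho> \<epsilon> by (auto simp: \<delta>_def)
    define Q where "Q = box (y - \<delta> *\<^sub>R One) (y + \<delta> *\<^sub>R One)"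
    have Q_iff: "z \<in> Q \<longleftrightarrow> (\<forall>i\<in>Basis. \<bar>inner z i - inner y i\<bar> < \<delta>)" for z
      unfolding Q_def mem_box by (auto simp: inner_diff_left inner_add_left abs_less_iff algebra_simps)
    have pos: "0 < g y * g z" if "z \<in> Q" for z
    proof (rule \<epsilon>(2))
      have "norm (z - y) \<le> (\<Sum>i\<in>Basis. \<bar>inner (z - y) i\<bar>)" by (rule norm_le_l1)
      also have "\<dots> \<le> (\<Sum>i\<in>(Basis :: 'a set). \<epsilon> / (2 * DIM('a)))"
        using that by (intro sum_mono) (auto simp: inner_diff_left Q_iff \<delta>_def intro: less_imp_le)
      also have "\<dots> < \<epsilon>" using \<epsilon> by simp
      finally show "dist z y < \<epsilon>" by (simp add: dist_norm)
    qed
    \<comment> \<open>In the direction \<open>e\<close> the function \<open>tensor h\<close> is a step up near \<open>y\<close> followed by a step down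
        near \<open>y + \<rho> *\<^sub>R e\<close>; its derivative is a positive bump \<open>\<eta>\<close> minus the translate of
        \<open>\<eta>\<close>. A plain antiderivative of \<open>\<eta>\<close> would not have compact support.\<close>
    define h where "h i = (if i = e
        then (\<lambda>t. smooth_step ((t - inner y e) / \<delta>) - smooth_step ((t - inner y e - \<rho>) / \<delta>))
        else bump (inner y i - \<delta>) (inner y i + \<delta>))" for i
    define h' where "h' i = (if i = e
        then (\<lambda>t. 2 / \<delta> * (tent ((t - inner y e) / \<delta>) - tent ((t - inner y e - \<rho>) / \<delta>)))
        else bump_deriv (inner y i - \<delta>) (inner y i + \<delta>))" for i
    define \<eta> where "\<eta> z = tent ((inner z e - inner y e) / \<delta>) * (\<Prod>i\<in>Basis - {e}. h i (inner z i))" for z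
    have deriv: "(h i has_real_derivative h' i t) (at t)" for i t
    proof (cases "i = e")
      case True
      have "((\<lambda>t. smooth_step ((t - c) / \<delta>)) has_real_derivative 2 * tent ((t - c) / \<delta>) * (1 / \<delta>)) (at t)" for c
        by (rule DERIV_chain2[OF has_real_derivative_smooth_step]) (use \<delta> in \<open>auto intro!: derivative_eq_intros\<close>)
      from DERIV_diff[OF this[of "inner y e"] this[of "inner y e + \<rho>"]]
      show ?thesis using True by (simp add: h_def h'_def algebra_simps)
    qed (simp add: h_def h'_def has_real_derivative_bump)
    have test: "test_function \<Omega> (tensor h)"
    proof (rule test_function_tensor[OF deriv])
      show "continuous_on UNIV (h' i)" for i
        using \<delta> by (auto simp: h'_def intro!: continuous_intros continuous_bump_deriv
            continuous_on_compose2[OF continuous_tent[of UNIV]])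
      let ?a = "y - \<delta> *\<^sub>R One" and ?b = "y + \<delta> *\<^sub>R One + \<rho> *\<^sub>R e"
      show "h i t = 0" if "i \<in> Basis" "t \<notin> {inner ?a i..inner ?b i}" for i t
      proof (cases "i = e")
        case True
        then have "t < inner y e - \<delta> \<or> inner y e + \<delta> + \<rho> < t"
          using that e by (auto simp: inner_diff_left inner_add_left)
        then have "((t - inner y e) / \<delta> \<le> - 1 \<and> (t - inner y e - \<rho>) / \<delta> \<le> - 1) \<or>
            (1 \<le> (t - inner y e) / \<delta> \<and> 1 \<le> (t - inner y e - \<rho>) / \<delta>)"
          using \<delta> \<rho> by (auto simp: field_simps)
        then show ?thesis using True by (auto simp: h_def smooth_step_left smooth_step_right)
      next
        case False
        then show ?thesis
          using that e by (auto simp: h_def inner_diff_left inner_add_left inner_Basis intro!: bump_zero)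
      qed
      show "cbox ?a ?b \<subseteq> \<Omega>"
      proof
        fix z assume "z \<in> cbox ?a ?b"
        then have "\<bar>inner z i - inner y i\<bar> \<le> 2 * \<rho>" if "i \<in> Basis" for i
          using that e \<delta> \<rho> by (force simp: mem_box inner_diff_left inner_add_left inner_Basis abs_le_iff split: if_splits)
        then show "z \<in> \<Omega>" by (rule near)
      qed
    qed
    have D: "frechet_derivative (tensor h) (at z) e = 2 / \<delta> * (\<eta> z - \<eta> (z - \<rho> *\<^sub>R e))" for z
    proof -
      have "(\<Prod>i\<in>Basis - {e}. h i (inner (z - \<rho> *\<^sub>R e) i)) = (\<Prod>i\<in>Basis - {e}. h i (inner z i))"
        using e by (intro prod.cong) (auto simp: inner_diff_left inner_Basis)
      then show ?thesis
        unfolding frechet_derivative_tensor[OF deriv e] \<eta>_def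
        using e by (simp add: h'_def inner_diff_left algebra_simps)
    qed
    have \<eta>_nonneg: "0 \<le> \<eta> z" for z
      unfolding \<eta>_def by (intro mult_nonneg_nonneg tent_nonneg prod_nonneg) (auto simp: h_def bump_nonneg)
    have \<eta>_pos: "0 < \<eta> z" if "z \<in> Q" for z
      unfolding \<eta>_def
    proof (intro mult_pos_pos tent_pos prod_pos)
      show "\<bar>(inner z e - inner y e) / \<delta>\<bar> < 1" using that e \<delta> by (simp add: Q_iff abs_divide)
      show "0 < h i (inner z i)" if "i \<in> Basis - {e}" for i
      proof -
        have "\<bar>inner z i - inner y i\<bar> < \<delta>" using that \<open>z \<in> Q\<close> by (simp add: Q_iff)
        then show ?thesis using that by (auto simp: h_def bump_pos_iff abs_less_iff)
      qed
    qed
    have \<eta>_zero: "\<eta> z = 0" if "z \<notin> Q" for z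
    proof -
      obtain i where i: "i \<in> Basis" "\<delta> \<le> \<bar>inner z i - inner y i\<bar>" using \<open>z \<notin> Q\<close> Q_iff by (metis not_le)
      show ?thesis
      proof (cases "i = e")
        case True
        then show ?thesis using i \<delta> by (simp add: \<eta>_def tent_zero abs_divide)
      next
        case False
        then have "h i (inner z i) = 0" using i by (auto simp: h_def intro!: bump_zero)
        then have "(\<Prod>i\<in>Basis - {e}. h i (inner z i)) = 0"
          using i False by (intro prod_zero) auto
        then show ?thesis by (simp add: \<eta>_def)
      qed
    qed
    have \<eta>_cont: "continuous_on UNIV \<eta>"
    proof -
      have "continuous_on UNIV (h i)" for i
        using deriv by (meson DERIV_isCont continuous_at_imp_continuous_on)
      then have "continuous_on UNIV (\<lambda>z. h i (inner z i))" for i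
        by (rule continuous_on_compose2) (auto intro: continuous_intros)
      then show ?thesis
        unfolding \<eta>_def using \<delta>
        by (intro continuous_intros continuous_on_compose2[OF continuous_tent[of UNIV]]) auto
    qed
    define F where "F z = indicator \<Omega> z * f z" for z
    have F_meas: "F \<in> borel_measurable borel"
      using borel_measurable_continuous_on_indicator[OF _ f] \<Omega> by (simp add: F_def[abs_def])
    have \<eta>_meas: "\<eta> \<in> borel_measurable borel" using \<eta>_cont by (rule borel_measurable_continuous_onI)
    have Q_sub: "z \<in> \<Omega>" "z + \<rho> *\<^sub>R e \<in> \<Omega>" if "z \<in> cbox (y - \<delta> *\<^sub>R One) (y + \<delta> *\<^sub>R One)" for z
    proof -
      have "\<bar>inner z i - inner y i\<bar> \<le> \<delta>" if "i \<in> Basis" for i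
        using \<open>z \<in> cbox _ _\<close> that by (force simp: mem_box inner_diff_left inner_add_left abs_le_iff)
      then show "z \<in> \<Omega>" "z + \<rho> *\<^sub>R e \<in> \<Omega>"
        using \<delta> \<rho> e by (force intro!: near simp: inner_add_left inner_Basis abs_le_iff)+
    qed
    let ?K = "cbox (y - \<delta> *\<^sub>R One) (y + \<delta> *\<^sub>R One)"
    have int: "integrable lborel (\<lambda>z. k z * \<eta> z)"
      if "continuous_on ?K k" "k \<in> borel_measurable borel" for k
    proof -
      have "integrable lborel (\<lambda>z. indicator ?K z *\<^sub>R (k z * \<eta> z))"
        using borel_integrable_compact[of ?K "\<lambda>z. k z * \<eta> z"] that \<eta>_cont
        by (auto intro!: continuous_intros intro: continuous_on_subset simp: if_distrib indicator_def cong: if_cong)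
      moreover have "indicator ?K z *\<^sub>R (k z * \<eta> z) = k z * \<eta> z" for z
        using \<eta>_zero[of z] box_subset_cbox by (force simp: Q_def indicator_def)
      ultimately show ?thesis by (simp only:)
    qed
    have int1: "integrable lborel (\<lambda>z. F z * \<eta> z)"
    proof (rule int)
      have "continuous_on ?K f" using f Q_sub by (blast intro: continuous_on_subset)
      then show "continuous_on ?K F"
        by (rule continuous_on_eq) (use Q_sub in \<open>auto simp: F_def\<close>)
    qed (rule F_meas)
    have shift_meas: "(\<lambda>z. F (z + \<rho> *\<^sub>R e)) \<in> borel_measurable borel"
      using F_meas by measurable
    have int2: "integrable lborel (\<lambda>z. F (z + \<rho> *\<^sub>R e) * \<eta> z)"
    proof (rule int)
      have "continuous_on ?K (\<lambda>z. f (z + \<rho> *\<^sub>R e))"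
        using Q_sub by (intro continuous_on_compose2[OF f] continuous_intros) auto
      then show "continuous_on ?K (\<lambda>z. F (z + \<rho> *\<^sub>R e))"
        by (rule continuous_on_eq) (use Q_sub in \<open>auto simp: F_def\<close>)
    qed (rule shift_meas)
    have shift: "(\<integral>z. k (z + \<rho> *\<^sub>R e) \<partial>lborel) = (\<integral>z. k z \<partial>lborel)"
      "integrable lborel k \<longleftrightarrow> integrable lborel (\<lambda>z. k (z + \<rho> *\<^sub>R e))"
      if "k \<in> borel_measurable borel" for k :: "'a \<Rightarrow> real"
    proof -
      show "(\<integral>z. k (z + \<rho> *\<^sub>R e) \<partial>lborel) = (\<integral>z. k z \<partial>lborel)"
        using integral_distr[of "(+) (\<rho> *\<^sub>R e)" lborel borel k] that lborel_distr_plus[of "\<rho> *\<^sub>R e"]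
        by (simp add: add.commute)
      show "integrable lborel k \<longleftrightarrow> integrable lborel (\<lambda>z. k (z + \<rho> *\<^sub>R e))"
        using integrable_distr_eq[of "(+) (\<rho> *\<^sub>R e)" lborel borel k] that lborel_distr_plus[of "\<rho> *\<^sub>R e"]
        by (simp add: add.commute)
    qed
    have m3: "(\<lambda>z. F z * \<eta> (z - \<rho> *\<^sub>R e)) \<in> borel_measurable borel"
      using F_meas \<eta>_meas by measurable
    have int3: "integrable lborel (\<lambda>z. F z * \<eta> (z - \<rho> *\<^sub>R e))"
      using shift(2)[OF m3] int2 by simp
    have "0 = (\<integral>z. f z * frechet_derivative (tensor h) (at z) e \<partial>lebesgue_on \<Omega>)"
      using zero[OF test] by simp
    also have "\<dots> = (\<integral>z. F z * frechet_derivative (tensor h) (at z) e \<partial>lebesgue)"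
      using \<Omega> by (subst integral_restrict_space) (auto simp: F_def mult.assoc)
    also have "\<dots> = (\<integral>z. 2 / \<delta> * (F z * \<eta> z - F z * \<eta> (z - \<rho> *\<^sub>R e)) \<partial>lebesgue)"
      unfolding D by (simp add: algebra_simps)
    also have "\<dots> = (\<integral>z. 2 / \<delta> * (F z * \<eta> z - F z * \<eta> (z - \<rho> *\<^sub>R e)) \<partial>lborel)"
      using m3 F_meas \<eta>_meas by (intro integral_completion) auto
    also have "\<dots> = 2 / \<delta> * ((\<integral>z. F z * \<eta> z \<partial>lborel) - (\<integral>z. F z * \<eta> (z - \<rho> *\<^sub>R e) \<partial>lborel))"
      using int1 int3 by simp
    also have "(\<integral>z. F z * \<eta> (z - \<rho> *\<^sub>R e) \<partial>lborel) = (\<integral>z. F (z + \<rho> *\<^sub>R e) * \<eta> z \<partial>lborel)"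
      using shift(1)[OF m3] by simp
    finally have "(\<integral>z. F z * \<eta> z \<partial>lborel) - (\<integral>z. F (z + \<rho> *\<^sub>R e) * \<eta> z \<partial>lborel) = 0"
      using \<delta> by simp
    \<comment> \<open>The factor \<open>g y\<close> makes the integrand nonnegative whatever the sign of \<open>g\<close> near \<open>y\<close>.\<close>
    then have int0: "(\<integral>z. g y * (F z * \<eta> z - F (z + \<rho> *\<^sub>R e) * \<eta> z) \<partial>lborel) = 0"
      using int1 int2 by simp
    have on_Q: "F z * \<eta> z - F (z + \<rho> *\<^sub>R e) * \<eta> z = g z * \<eta> z" for z
    proof (cases "z \<in> Q")
      case True
      then have "z \<in> ?K" using box_subset_cbox by (auto simp: Q_def)
      then show ?thesis using Q_sub by (simp add: F_def g_def algebra_simps)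
    qed (simp add: \<eta>_zero)
    have nonneg: "0 \<le> g y * (g z * \<eta> z)" for z
      using pos[of z] \<eta>_nonneg[of z] \<eta>_zero[of z]
      by (cases "z \<in> Q") (auto simp flip: mult.assoc)
    have "integrable lborel (\<lambda>z. g y * (g z * \<eta> z))"
      using int1 int2 unfolding on_Q[symmetric] by auto
    then have "AE z in lborel. g y * (g z * \<eta> z) = 0"
      using int0 nonneg unfolding on_Q by (subst (asm) integral_nonneg_eq_0_iff_AE) auto
    then have "AE z in lborel. z \<notin> Q"
    proof eventually_elim
      case (elim z)
      show ?case
      proof
        assume z: "z \<in> Q"
        then have "0 < g y * g z * \<eta> z" using pos[OF z] \<eta>_pos[OF z] by simp
        then show False using elim by (simp add: mult.assoc)
      qed
    qed
    then have "Q \<in> null_sets lborel"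
      using AE_iff_null_sets[of Q lborel] by (simp add: Q_def)
    then have "negligible Q" by (simp add: negligible_iff_null_sets null_sets_completionI)
    moreover have "y \<in> Q" using \<delta> by (simp add: Q_iff)
    moreover have "open Q" by (simp add: Q_def open_box)
    ultimately show False using open_not_negligible by blast
  qed
  then show ?thesis using \<rho> ye by (auto simp: g_def)
qed

text \<open>Among the points of the closure where \<open>f\<close> takes the value \<open>f x\<close>, take one that lies farthest in the
  direction \<open>e\<close>. It is not in \<open>\<Omega>\<close>, because \<open>f\<close> is locally constant in this direction there; so it
  lies on the boundary, where \<open>f\<close> vanishes.\<close>

lemma eq_0_if_weak_directional_derivative_0:
  fixes f :: "'a::euclidean_space \<Rightarrow> real"
  assumes \<Omega>: "open \<Omega>" "bounded \<Omega>" and f: "continuous_on (closure \<Omega>) f" "\<And>x. x \<in> frontier \<Omega> \<Longrightarrow> f x = 0"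
    and e: "e \<in> Basis"
    and zero: "\<And>\<psi>. test_function \<Omega> \<psi> \<Longrightarrow>
      (\<integral>x. f x * frechet_derivative \<psi> (at x) e \<partial>lebesgue_on \<Omega>) = 0"
    and x: "x \<in> \<Omega>"
  shows "f x = 0"
proof -
  define K where "K = {z \<in> closure \<Omega>. f z = f x}"
  have "closed K"
    unfolding K_def by (rule continuous_closed_preimage_constant[OF f(1)]) simp
  then have "compact K"
    using \<Omega>(2) by (simp add: compact_eq_bounded_closed bounded_subset[OF bounded_closure[OF \<Omega>(2)]] K_def)
  moreover have "x \<in> K" using x closure_subset by (auto simp: K_def)
  ultimately obtain z where z: "z \<in> K" "\<And>w. w \<in> K \<Longrightarrow> inner w e \<le> inner z e"
    using continuous_attains_sup[of K "\<lambda>w. inner w e"] continuous_on_inner[of K "\<lambda>w. w" "\<lambda>_. e"]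
    by auto
  have "z \<notin> \<Omega>"
  proof
    assume "z \<in> \<Omega>"
    then obtain \<rho> where \<rho>: "\<rho> > 0" "z + \<rho> *\<^sub>R e \<in> \<Omega>" "f (z + \<rho> *\<^sub>R e) = f z"
      using locally_constant_in_direction[OF \<Omega>(1) continuous_on_subset[OF f(1) closure_subset] e zero]
      by blast
    then have "z + \<rho> *\<^sub>R e \<in> K" using z(1) closure_subset by (auto simp: K_def)
    then show False using z(2)[of "z + \<rho> *\<^sub>R e"] \<rho> e by (simp add: inner_add_left)
  qed
  then have "z \<in> frontier \<Omega>" using z(1) \<Omega>(1) by (auto simp: K_def frontier_def interior_open)
  then show ?thesis using f(2) z(1) by (auto simp: K_def)
qed

section \<open>Patches\<close>

text \<open>The least union of elements consists of the elements whose interior meets the open set \<open>S\<close> where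
  \<open>f\<close> does not vanish. An element that meets \<open>S\<close> does so with its interior, being the closure of the
  latter; therefore these elements cover \<open>S\<close>. None of them is dispensable, since its interior
  is disjoint from that of any other element and hence from the other element itself.\<close>

lemma smallest_patch_closed_cover:
  fixes f :: "'a::euclidean_space \<Rightarrow> real"
  assumes \<Omega>: "open \<Omega>" and \<T>: "element_decomposition \<Omega> \<T>" and f: "continuous_on \<Omega> f"
  shows "closed (smallest_patch \<Omega> \<T> f)" "support_on \<Omega> f \<subseteq> smallest_patch \<Omega> \<T> f"
proof -
  define S where "S = {x \<in> \<Omega>. f x \<noteq> 0}"
  define F where "F = {T \<in> \<T>. interior T \<inter> S \<noteq> {}}"
  have "open (\<Omega> \<inter> f -` (- {0}))"
    by (rule continuous_open_preimage[OF f \<Omega>]) auto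
  moreover have "\<Omega> \<inter> f -` (- {0}) = S" by (auto simp: S_def)
  ultimately have S: "open S" by simp
  have fin: "finite \<T>" and cover: "\<Union>\<T> = closure \<Omega>"
    and elem: "\<And>T. T \<in> \<T> \<Longrightarrow> compact T \<and> closure (interior T) = T"
    and disj: "\<And>T T'. T \<in> \<T> \<Longrightarrow> T' \<in> \<T> \<Longrightarrow> T \<noteq> T' \<Longrightarrow> interior T \<inter> interior T' = {}"
    using \<T> by (auto simp: element_decomposition_def)
  have meets: "interior T \<inter> G \<noteq> {}" if "T \<in> \<T>" "open G" "T \<inter> G \<noteq> {}" for T G
    using that elem open_Int_closure_eq_empty[of G "interior T"] by (auto simp: Int_commute)
  have closed: "closed (\<Union>F)"
    using fin elem by (intro closed_Union) (auto simp: F_def compact_imp_closed)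
  have "S \<subseteq> \<Union>F"
  proof
    fix x assume x: "x \<in> S"
    then have "x \<in> closure \<Omega>" using closure_subset by (auto simp: S_def)
    then obtain T where "T \<in> \<T>" "x \<in> T" using cover by blast
    then show "x \<in> \<Union>F" using meets[of T S] S x by (auto simp: F_def)
  qed
  then have sub: "support_on \<Omega> f \<subseteq> \<Union>F"
    using closed unfolding support_on_def S_def by (rule closure_minimal)
  have least: "\<Union>F \<subseteq> \<Union>F'" if F': "F' \<subseteq> \<T>" "support_on \<Omega> f \<subseteq> \<Union>F'" for F'
  proof -
    have "T \<in> F'" if "T \<in> F" for T
    proof -
      obtain x where x: "x \<in> interior T" "x \<in> S" "T \<in> \<T>" using \<open>T \<in> F\<close> by (auto simp: F_def)
      have "S \<subseteq> support_on \<Omega> f" unfolding support_on_def S_def by (rule closure_subset)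
      then have "x \<in> support_on \<Omega> f" using x by blast
      then obtain T' where T': "T' \<in> F'" "x \<in> T'" using F'(2) by blast
      then have "interior T' \<inter> interior T \<noteq> {}"
        using meets[of T' "interior T"] x F'(1) by auto
      then have "T' = T" using disj[of T' T] T' F'(1) x(3) by blast
      then show ?thesis using T' by simp
    qed
    then show ?thesis by blast
  qed
  have F_sub: "F \<subseteq> \<T>" by (auto simp: F_def)
  have "smallest_patch \<Omega> \<T> f = \<Union>F"
    unfolding smallest_patch_def
  proof (rule Least_equality)
    show "(\<exists>F'\<subseteq>\<T>. \<Union>F = \<Union>F') \<and> support_on \<Omega> f \<subseteq> \<Union>F"
      using sub F_sub by blast
  qed (use least in blast)
  then show "closed (smallest_patch \<Omega> \<T> f)" "support_on \<Omega> f \<subseteq> smallest_patch \<Omega> \<T> f"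
    using closed sub by auto
qed

section \<open>Strain, energy and essential bounds\<close>

lemma strain_carrier:
  "d = 2 \<and> m = 3 \<or> d = 3 \<and> m = 6 \<Longrightarrow> strain d b \<Omega> u x \<in> carrier_vec m"
  by (auto simp: strain_def Let_def intro!: carrier_vecI)

text \<open>The first \<open>d\<close> components are the diagonal derivatives, from which the definiteness of the energy
  will follow.\<close>

lemma strain_index:
  assumes "d = 2 \<and> m = 3 \<or> d = 3 \<and> m = 6" "i < m"
  shows "strain d b \<Omega> u x $ i = (let D = (\<lambda>j i. inner (weak_gradient \<Omega> (u i) x) (b j)) in
    if i < d then D (i + 1) (i + 1)
    else if d = 2 \<or> i = 3 then D 2 1 + D 1 2 else if i = 4 then D 3 2 + D 2 3 else D 3 1 + D 1 3)"
proof -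
  have "d = 2 \<and> (i = 0 \<or> i = 1 \<or> i = 2) \<or>
      d = 3 \<and> (i = 0 \<or> i = 1 \<or> i = 2 \<or> i = 3 \<or> i = 4 \<or> i = 5)"
    using assms by auto
  then show ?thesis
    by (elim disjE conjE) (simp_all add: strain_def Let_def vec_of_list_index numeral_nat)
qed

lemma L2_strain:
  fixes u :: "nat \<Rightarrow> 'a::euclidean_space \<Rightarrow> real"
  assumes dm: "d = 2 \<and> m = 3 \<or> d = 3 \<and> m = 6" and u: "\<And>i. i \<in> {1..d} \<Longrightarrow> u i \<in> H1 \<Omega>" and "i < m"
  shows "L2 \<Omega> (\<lambda>x. strain d b \<Omega> u x $ i)"
proof -
  have D: "L2 \<Omega> (\<lambda>x. inner (weak_gradient \<Omega> (u k) x) (b j))" if "k \<in> {1..d}" for j k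
    using is_weak_gradient_weak_gradient[OF u[OF that]]
    by (intro L2_inner) (simp add: is_weak_gradient_def)
  show ?thesis
    unfolding strain_index[OF dm \<open>i < m\<close>] Let_def
    using dm \<open>i < m\<close> by (cases "i < d"; cases "i = 3"; cases "i = 4") (auto intro!: D L2_add)
qed

lemma strain_eq_0:
  assumes "d = 2 \<and> m = 3 \<or> d = 3 \<and> m = 6" "\<And>i. i \<in> {1..d} \<Longrightarrow> weak_gradient \<Omega> (u i) x = 0"
  shows "strain d b \<Omega> u x = 0\<^sub>v m"
proof (rule eq_vecI)
  fix i assume "i < dim_vec (0\<^sub>v m :: real vec)"
  then show "strain d b \<Omega> u x $ i = 0\<^sub>v m $ i"
    using assms by (auto simp: strain_index[OF assms(1)] Let_def)
qed (use strain_carrier[OF assms(1), of b \<Omega> u x] in auto)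

lemma scalar_prod_self_eq_0_iff:
  fixes v :: "real vec"
  assumes "v \<in> carrier_vec n"
  shows "scalar_prod v v = 0 \<longleftrightarrow> v = 0\<^sub>v n"
proof
  assume "scalar_prod v v = 0"
  then have "(\<Sum>i = 0..<n. v $ i * v $ i) = 0" using assms by (simp add: scalar_prod_def)
  then have "\<forall>i\<in>{0..<n}. v $ i * v $ i = 0"
    by (subst (asm) sum_nonneg_eq_0_iff) auto
  then show "v = 0\<^sub>v n" using assms by (intro eq_vecI) auto
qed simp

lemma scalar_prod_self_nonneg: "0 \<le> scalar_prod v (v :: real vec)"
  by (auto simp: scalar_prod_def intro: sum_nonneg)

text \<open>Bounded coefficients times products of square integrable functions.\<close>

lemma integrable_energy:
  fixes C :: "'a::euclidean_space \<Rightarrow> real mat" and s t :: "'a \<Rightarrow> real vec"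
  assumes C: "material_data m \<Omega> C"
    and s: "\<And>x. s x \<in> carrier_vec m" "\<And>i. i < m \<Longrightarrow> L2 \<Omega> (\<lambda>x. s x $ i)"
    and t: "\<And>x. t x \<in> carrier_vec m" "\<And>i. i < m \<Longrightarrow> L2 \<Omega> (\<lambda>x. t x $ i)"
  shows "integrable (lebesgue_on \<Omega>) (\<lambda>x. scalar_prod (s x) (C x *\<^sub>v t x))"
proof -
  obtain K where K: "\<And>i j. i < m \<Longrightarrow> j < m \<Longrightarrow> AE x in lebesgue_on \<Omega>. \<bar>C x $$ (i, j)\<bar> \<le> K"
    using C unfolding material_data_def by blast
  have meas: "(\<lambda>x. C x $$ (i, j)) \<in> borel_measurable (lebesgue_on \<Omega>)" if "i < m" "j < m" for i j
    using C that by (simp add: material_data_def)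
  have "integrable (lebesgue_on \<Omega>) (\<lambda>x. s x $ i * C x $$ (i, j) * t x $ j)" if ij: "i < m" "j < m" for i j
  proof (rule Bochner_Integration.integrable_bound)
    show "integrable (lebesgue_on \<Omega>) (\<lambda>x. K * (s x $ i * t x $ j))"
      using L2_integrable_mult[OF s(2)[OF ij(1)] t(2)[OF ij(2)]] by simp
    show "(\<lambda>x. s x $ i * C x $$ (i, j) * t x $ j) \<in> borel_measurable (lebesgue_on \<Omega>)"
      using meas[OF ij] s(2)[OF ij(1)] t(2)[OF ij(2)] by (auto simp: L2_def)
    show "AE x in lebesgue_on \<Omega>. norm (s x $ i * C x $$ (i, j) * t x $ j) \<le> norm (K * (s x $ i * t x $ j))"
      using K[OF ij]
    proof eventually_elim
      case (elim x)
      then have "\<bar>C x $$ (i, j)\<bar> * \<bar>s x $ i * t x $ j\<bar> \<le> \<bar>K\<bar> * \<bar>s x $ i * t x $ j\<bar>"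
        by (intro mult_right_mono) auto
      then show ?case by (simp add: abs_mult ac_simps)
    qed
  qed
  then have "integrable (lebesgue_on \<Omega>) (\<lambda>x. \<Sum>i<m. \<Sum>j<m. s x $ i * C x $$ (i, j) * t x $ j)"
    by (intro Bochner_Integration.integrable_sum) auto
  moreover have "scalar_prod (s x) (C x *\<^sub>v t x) = (\<Sum>i<m. \<Sum>j<m. s x $ i * C x $$ (i, j) * t x $ j)"
    if "x \<in> space (lebesgue_on \<Omega>)" for x
    using C that by (intro scalar_prod_mult_mat_vec s t) (auto simp: material_data_def)
  ultimately show ?thesis
    by (subst Bochner_Integration.integrable_cong[OF refl]) auto
qed

text \<open>The essential supremum of a function that is not measurable is infinite by convention. The bounds
  hold in this case too, which covers the extreme eigenvalues of a varying matrix without any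
  discussion of their measurability.\<close>

lemma AE_lebesgue_on_ge_ess_inf:
  assumes P: "closed P" and \<Omega>: "open \<Omega>" and t: "ereal t \<le> ess_inf_on P f"
  shows "AE x in lebesgue_on \<Omega>. x \<in> P \<longrightarrow> t \<le> f x"
proof -
  have "AE x in lebesgue_on P. - ereal (f x) \<le> - ess_inf_on P f"
    unfolding ess_inf_on_def using esssup_AE[of "\<lambda>x. - ereal (f x)" "lebesgue_on P"] by simp
  then have "AE x in lebesgue_on P. t \<le> f x"
  proof eventually_elim
    case (elim x)
    then have "ess_inf_on P f \<le> ereal (f x)" using ereal_minus_le_minus by blast
    then show ?case using t order_trans ereal_less_eq(3) by blast
  qed
  then have "AE x in lebesgue. x \<in> P \<longrightarrow> t \<le> f x"
    using P by (subst (asm) AE_restrict_space_iff) auto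
  then show ?thesis
    using \<Omega> by (subst AE_restrict_space_iff) (auto elim: eventually_mono)
qed

lemma AE_lebesgue_on_le_ess_sup:
  assumes P: "closed P" and \<Omega>: "open \<Omega>" and t: "ess_sup_on P f \<le> ereal t"
  shows "AE x in lebesgue_on \<Omega>. x \<in> P \<longrightarrow> f x \<le> t"
proof -
  have "AE x in lebesgue_on P. ereal (f x) \<le> ess_sup_on P f"
    unfolding ess_sup_on_def by (rule esssup_AE)
  then have "AE x in lebesgue_on P. f x \<le> t"
  proof eventually_elim
    case (elim x)
    then show ?case using t order_trans ereal_less_eq(3) by blast
  qed
  then have "AE x in lebesgue. x \<in> P \<longrightarrow> f x \<le> t"
    using P by (subst (asm) AE_restrict_space_iff) auto
  then show ?thesis
    using \<Omega> by (subst AE_restrict_space_iff) (auto elim: eventually_mono)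
qed

definition symmetric_positive_definite :: "nat \<Rightarrow> real mat \<Rightarrow> bool" where
  "symmetric_positive_definite n B \<longleftrightarrow> B \<in> carrier_mat n n \<and> transpose_mat B = B \<and>
     (\<forall>v\<in>carrier_vec n. v \<noteq> 0\<^sub>v n \<longrightarrow> 0 < scalar_prod v (B *\<^sub>v v))"

lemma AE_material_spd:
  assumes "material_data m \<Omega> C"
  shows "AE x in lebesgue_on \<Omega>. symmetric_positive_definite m (C x)"
proof -
  obtain c where c: "c > 0" and ell: "AE x in lebesgue_on \<Omega>. \<forall>\<xi>\<in>carrier_vec m.
      c * scalar_prod \<xi> \<xi> \<le> scalar_prod \<xi> (C x *\<^sub>v \<xi>)"
    using assms unfolding material_data_def by blast
  have sym: "AE x in lebesgue_on \<Omega>. transpose_mat (C x) = C x"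
    and carrier: "AE x in lebesgue_on \<Omega>. C x \<in> carrier_mat m m"
    using assms by (auto simp: material_data_def intro!: AE_I2)
  from ell sym carrier show ?thesis
  proof eventually_elim
    case (elim x)
    have "0 < scalar_prod \<xi> (C x *\<^sub>v \<xi>)" if "\<xi> \<in> carrier_vec m" "\<xi> \<noteq> 0\<^sub>v m" for \<xi>
    proof -
      have "0 < scalar_prod \<xi> \<xi>"
        using scalar_prod_self_eq_0_iff[OF that(1)] scalar_prod_self_nonneg[of \<xi>] that(2) by linarith
      then have "0 < c * scalar_prod \<xi> \<xi>" using c by simp
      also have "\<dots> \<le> scalar_prod \<xi> (C x *\<^sub>v \<xi>)" using elim(1) that(1) by blast
      finally show ?thesis .
    qed
    then show ?case using elim by (simp add: symmetric_positive_definite_def)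
  qed
qed

section \<open>Stiffness matrices\<close>

locale fe_space =
  fixes \<Omega> :: "'a::euclidean_space set" and b :: "nat \<Rightarrow> 'a" and \<phi> :: "nat \<Rightarrow> 'a \<Rightarrow> real"
    and d m N :: nat
  assumes dm: "d = 2 \<and> m = 3 \<or> d = 3 \<and> m = 6"
    and basis: "\<And>i. i \<in> {1..d} \<Longrightarrow> b i \<in> Basis"
    and \<Omega>: "open \<Omega>" "bounded \<Omega>"
    and V0: "\<And>k. k \<in> {1..N} \<Longrightarrow> \<phi> k \<in> V0_cont \<Omega>"
    and independent: "\<And>c k. (\<forall>x\<in>\<Omega>. (\<Sum>k=1..N. c k * \<phi> k x) = 0) \<Longrightarrow> k \<in> {1..N} \<Longrightarrow> c k = (0 :: real)"
begin

definition fe_strain :: "real vec \<Rightarrow> 'a \<Rightarrow> real vec" where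
  "fe_strain v = strain d b \<Omega> (fe_function N \<phi> v)"

lemma patch_closed_cover:
  assumes "element_decomposition \<Omega> \<T>" "k \<in> {1..N}"
  shows "closed (smallest_patch \<Omega> \<T> (\<phi> k))" "support_on \<Omega> (\<phi> k) \<subseteq> smallest_patch \<Omega> \<T> (\<phi> k)"
proof -
  have "continuous_on (closure \<Omega>) (\<phi> k)" using V0[OF assms(2)] by (simp add: V0_cont_def)
  then have "continuous_on \<Omega> (\<phi> k)" using closure_subset by (rule continuous_on_subset)
  from smallest_patch_closed_cover[OF \<Omega>(1) assms(1) this]
  show "closed (smallest_patch \<Omega> \<T> (\<phi> k))" "support_on \<Omega> (\<phi> k) \<subseteq> smallest_patch \<Omega> \<T> (\<phi> k)" .
qed

lemma fe_function_H1: "fe_function N \<phi> v i \<in> H1 \<Omega>"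
  unfolding fe_function_def[abs_def]
  by (rule H1_lin_comb[OF \<Omega>]) (use V0 in \<open>auto simp: V0_cont_def\<close>)

lemma fe_function_continuous: "continuous_on (closure \<Omega>) (fe_function N \<phi> v i)"
  unfolding fe_function_def[abs_def] using V0 by (auto simp: V0_cont_def intro!: continuous_intros)

lemma fe_function_frontier: "x \<in> frontier \<Omega> \<Longrightarrow> fe_function N \<phi> v i x = 0"
  unfolding fe_function_def using V0 by (auto simp: V0_cont_def)

lemma fe_strain_carrier: "fe_strain v x \<in> carrier_vec m"
  unfolding fe_strain_def by (rule strain_carrier[OF dm])

lemma fe_strain_L2: "i < m \<Longrightarrow> L2 \<Omega> (\<lambda>x. fe_strain v x $ i)"
  unfolding fe_strain_def by (rule L2_strain[OF dm fe_function_H1])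

lemma energy_integrable:
  "material_data m \<Omega> C \<Longrightarrow> integrable (lebesgue_on \<Omega>) (\<lambda>x. scalar_prod (fe_strain w x) (C x *\<^sub>v fe_strain v x))"
  by (rule integrable_energy) (auto intro: fe_strain_carrier fe_strain_L2)

lemma stiffness_form:
  assumes "is_stiffness_matrix d b \<Omega> N \<phi> C A" "v \<in> carrier_vec (d * N)" "w \<in> carrier_vec (d * N)"
  shows "scalar_prod w (A *\<^sub>v v) = (\<integral>x. scalar_prod (fe_strain w x) (C x *\<^sub>v fe_strain v x) \<partial>lebesgue_on \<Omega>)"
  using assms by (simp add: is_stiffness_matrix_def fe_strain_def)

text \<open>The definiteness of the energy, which is usually deduced from Korn's inequality. The components \<open>i\<close> of the strain for \<open>i < d\<close> are the
  derivatives of the displacement component in its own coordinate direction. If they vanish,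
  every displacement component is constant along lines in that direction up to the boundary,
  where it is zero.\<close>

lemma strain_eq_0_imp_coefficients_eq_0:
  assumes v: "v \<in> carrier_vec (d * N)" and zero: "AE x in lebesgue_on \<Omega>. fe_strain v x = 0\<^sub>v m"
  shows "v = 0\<^sub>v (d * N)"
proof -
  let ?u = "fe_function N \<phi> v"
  have u0: "?u i x = 0" if i: "i \<in> {1..d}" and x: "x \<in> \<Omega>" for i x
  proof (rule eq_0_if_weak_directional_derivative_0[OF \<Omega> fe_function_continuous fe_function_frontier basis[OF i] _ x])
    fix \<psi> assume \<psi>: "test_function \<Omega> \<psi>"
    have wg: "is_weak_gradient \<Omega> (?u i) (weak_gradient \<Omega> (?u i))"
      by (rule is_weak_gradient_weak_gradient[OF fe_function_H1])
    have D0: "AE x in lebesgue_on \<Omega>. inner (weak_gradient \<Omega> (?u i) x) (b i) * \<psi> x = 0"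
      using zero
    proof eventually_elim
      case (elim x)
      have less: "i - 1 < m" "i - 1 < d" "i - 1 + 1 = i" using i dm by auto
      have "fe_strain v x $ (i - 1) = 0" using elim less by simp
      moreover have "fe_strain v x $ (i - 1) = inner (weak_gradient \<Omega> (?u i) x) (b i)"
        unfolding fe_strain_def strain_index[OF dm less(1)] Let_def less(3) by (simp only: less(2) if_True)
      ultimately show ?case by simp
    qed
    have "(\<integral>x. ?u i x * frechet_derivative \<psi> (at x) (b i) \<partial>lebesgue_on \<Omega>)
        = - (\<integral>x. inner (weak_gradient \<Omega> (?u i) x) (b i) * \<psi> x \<partial>lebesgue_on \<Omega>)"
      using wg \<psi> basis[OF i] by (simp add: is_weak_gradient_def)
    then show "(\<integral>x. ?u i x * frechet_derivative \<psi> (at x) (b i) \<partial>lebesgue_on \<Omega>) = 0"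
      using integral_eq_zero_AE[OF D0] by simp
  qed auto
  show ?thesis
  proof (rule eq_vecI)
    fix l assume "l < dim_vec (0\<^sub>v (d * N) :: real vec)"
    then have l: "l < d * N" by simp
    then have N: "0 < N" by (cases N) auto
    \<comment> \<open>The entry \<open>l\<close> belongs to the component \<open>i\<close> and the node \<open>k\<close>.\<close>
    define i where "i = l div N + 1"
    define k where "k = l mod N + 1"
    have "l div N < d" using l N by (simp add: less_mult_imp_div_less)
    then have i: "i \<in> {1..d}" by (simp add: i_def)
    have k: "k \<in> {1..N}" using N by (simp add: k_def Suc_leI)
    have "v $ ((i - 1) * N + (k - 1)) = 0"
      by (rule independent[of "\<lambda>k. v $ ((i - 1) * N + (k - 1))", OF _ k])
        (use u0[OF i] in \<open>simp add: fe_function_def\<close>)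
    then show "v $ l = 0\<^sub>v (d * N) $ l" using l by (simp add: i_def k_def)
  qed (use v in simp)
qed

lemma stiffness_spd:
  assumes C: "material_data m \<Omega> C" and A: "is_stiffness_matrix d b \<Omega> N \<phi> C A"
  shows "symmetric_positive_definite (d * N) A"
  unfolding symmetric_positive_definite_def
proof (intro conjI ballI impI)
  let ?n = "d * N"
  show A_carrier: "A \<in> carrier_mat ?n ?n" using A by (simp add: is_stiffness_matrix_def)
  have sym: "scalar_prod w (A *\<^sub>v v) = scalar_prod v (A *\<^sub>v w)"
    if "v \<in> carrier_vec ?n" "w \<in> carrier_vec ?n" for v w
    unfolding stiffness_form[OF A that] stiffness_form[OF A that(2,1)]
  proof (rule integral_cong_AE)
    show "AE x in lebesgue_on \<Omega>. scalar_prod (fe_strain w x) (C x *\<^sub>v fe_strain v x) = scalar_prod (fe_strain v x) (C x *\<^sub>v fe_strain w x)"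
      using AE_material_spd[OF C]
    proof eventually_elim
      case (elim x)
      then show ?case
        by (intro bilinear_form_symmetric[of _ m] fe_strain_carrier) (auto simp: symmetric_positive_definite_def)
    qed
  qed (use energy_integrable[OF C] in blast)+
  show "transpose_mat A = A"
  proof (rule eq_matI)
    fix i j assume "i < dim_row A" "j < dim_col A"
    then have ij: "i < ?n" "j < ?n" using A_carrier by auto
    have "A $$ (k, l) = scalar_prod (unit_vec ?n k) (A *\<^sub>v unit_vec ?n l)" if "k < ?n" "l < ?n" for k l
      using that A_carrier by (simp add: scalar_prod_left_unit[of _ ?n])
    then show "transpose_mat A $$ (i, j) = A $$ (i, j)"
      using ij A_carrier sym[of "unit_vec ?n i" "unit_vec ?n j"] by simp
  qed (use A_carrier in auto)
  fix v :: "real vec" assume v: "v \<in> carrier_vec ?n" "v \<noteq> 0\<^sub>v ?n"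
  let ?q = "\<lambda>x. scalar_prod (fe_strain v x) (C x *\<^sub>v fe_strain v x)"
  have pos: "AE x in lebesgue_on \<Omega>. 0 \<le> ?q x \<and> (?q x = 0 \<longrightarrow> fe_strain v x = 0\<^sub>v m)"
    using AE_material_spd[OF C]
  proof eventually_elim
    case (elim x)
    show ?case
    proof (cases "fe_strain v x = 0\<^sub>v m")
      case False
      then have "0 < ?q x" using elim fe_strain_carrier by (simp add: symmetric_positive_definite_def)
      then show ?thesis by simp
    next
      case True
      have "C x \<in> carrier_mat m m" using elim by (simp add: symmetric_positive_definite_def)
      then show ?thesis unfolding True by simp
    qed
  qed
  then have nonneg: "AE x in lebesgue_on \<Omega>. 0 \<le> ?q x" by eventually_elim simp
  have "(\<integral>x. ?q x \<partial>lebesgue_on \<Omega>) \<noteq> 0"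
  proof
    assume "(\<integral>x. ?q x \<partial>lebesgue_on \<Omega>) = 0"
    then have "AE x in lebesgue_on \<Omega>. ?q x = 0"
      using integral_nonneg_eq_0_iff_AE[OF energy_integrable[OF C] nonneg] by simp
    with pos have "AE x in lebesgue_on \<Omega>. fe_strain v x = 0\<^sub>v m" by eventually_elim simp
    then show False using strain_eq_0_imp_coefficients_eq_0 v by blast
  qed
  moreover have "0 \<le> (\<integral>x. ?q x \<partial>lebesgue_on \<Omega>)" by (rule integral_nonneg_AE[OF nonneg])
  ultimately show "0 < scalar_prod v (A *\<^sub>v v)" using stiffness_form[OF A v(1) v(1)] by simp
qed

text \<open>Here \<open>S\<close> collects the nodes that may have nonzero coefficients. The part of
  \<open>\<Omega>\<close> off their patches is open, so that not only the displacement vanishes there but also, almost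
  everywhere, its weak gradient.\<close>

lemma strain_eq_0_off_patches:
  assumes \<T>: "element_decomposition \<Omega> \<T>" and S: "S \<subseteq> {1..N}"
    and v: "\<And>i k. i \<in> {1..d} \<Longrightarrow> k \<in> {1..N} - S \<Longrightarrow> v $ ((i - 1) * N + (k - 1)) = 0"
  shows "AE x in lebesgue_on \<Omega>. x \<notin> (\<Union>k\<in>S. smallest_patch \<Omega> \<T> (\<phi> k)) \<longrightarrow> fe_strain v x = 0\<^sub>v m"
proof -
  define U where "U = \<Omega> - (\<Union>k\<in>S. smallest_patch \<Omega> \<T> (\<phi> k))"
  have "finite S" using S finite_subset by blast
  then have "closed (\<Union>k\<in>S. smallest_patch \<Omega> \<T> (\<phi> k))"
    using S by (intro closed_UN patch_closed_cover[OF \<T>] ballI) auto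
  then have U: "open U" "U \<subseteq> \<Omega>" using \<Omega> by (auto simp: U_def)
  have "AE x in lebesgue_on \<Omega>. x \<in> U \<longrightarrow> weak_gradient \<Omega> (fe_function N \<phi> v i) x = 0" if i: "i \<in> {1..d}" for i
  proof (rule weak_gradient_eq_0_where_function_eq_0[OF \<Omega> is_weak_gradient_weak_gradient[OF fe_function_H1] U])
    fix x assume x: "x \<in> U"
    have "v $ ((i - 1) * N + (k - 1)) * \<phi> k x = 0" if k: "k \<in> {1..N}" for k
    proof (cases "k \<in> S")
      case True
      then have "x \<notin> smallest_patch \<Omega> \<T> (\<phi> k)" using x by (auto simp: U_def)
      then have "x \<notin> support_on \<Omega> (\<phi> k)" using patch_closed_cover(2)[OF \<T> k] by blast
      then have "x \<notin> {x \<in> \<Omega>. \<phi> k x \<noteq> 0}"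
        unfolding support_on_def using closure_subset[of "{x \<in> \<Omega>. \<phi> k x \<noteq> 0}"] by blast
      then show ?thesis using x by (simp add: U_def)
    qed (use v i k in simp)
    then show "fe_function N \<phi> v i x = 0"
      unfolding fe_function_def by (intro sum.neutral ballI)
  qed
  then have "AE x in lebesgue_on \<Omega>. \<forall>i\<in>{1..d}. x \<in> U \<longrightarrow> weak_gradient \<Omega> (fe_function N \<phi> v i) x = 0"
    using AE_ball_countable'[where I = "{1..d}" and M = "lebesgue_on \<Omega>" and
      P = "\<lambda>i x. x \<in> U \<longrightarrow> weak_gradient \<Omega> (fe_function N \<phi> v i) x = 0"] by (simp add: countable_finite)
  moreover have "AE x in lebesgue_on \<Omega>. x \<in> \<Omega>" by (rule AE_I2) simp
  ultimately show ?thesis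
  proof eventually_elim
    case (elim x)
    then show ?case unfolding fe_strain_def by (auto simp: U_def intro!: strain_eq_0[OF dm])
  qed
qed

text \<open>The coefficients \<open>\<alpha>, \<beta>\<close> are \<open>1, -t\<close> for the lower bound and \<open>-1, t\<close> for the upper bound. The
  pointwise inequality is assumed on the patches of the nodes in \<open>S\<close>; elsewhere the strain
  vanishes.\<close>

lemma form_combination_nonneg:
  assumes \<T>: "element_decomposition \<Omega> \<T>" and C: "material_data m \<Omega> C" "material_data m \<Omega> Ct"
    and A: "is_stiffness_matrix d b \<Omega> N \<phi> C A" "is_stiffness_matrix d b \<Omega> N \<phi> Ct At"
    and S: "S \<subseteq> {1..N}"
    and v: "v \<in> carrier_vec (d * N)"
      "\<And>i k. i \<in> {1..d} \<Longrightarrow> k \<in> {1..N} - S \<Longrightarrow> v $ ((i - 1) * N + (k - 1)) = 0"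
    and nonneg: "\<And>k. k \<in> S \<Longrightarrow> AE x in lebesgue_on \<Omega>. x \<in> smallest_patch \<Omega> \<T> (\<phi> k) \<longrightarrow>
      (\<forall>\<xi>\<in>carrier_vec m. 0 \<le> \<alpha> * scalar_prod \<xi> (C x *\<^sub>v \<xi>) + \<beta> * scalar_prod \<xi> (Ct x *\<^sub>v \<xi>))"
  shows "0 \<le> \<alpha> * scalar_prod v (A *\<^sub>v v) + \<beta> * scalar_prod v (At *\<^sub>v v)"
proof -
  let ?q = "\<lambda>x. \<alpha> * scalar_prod (fe_strain v x) (C x *\<^sub>v fe_strain v x) + \<beta> * scalar_prod (fe_strain v x) (Ct x *\<^sub>v fe_strain v x)"
  have "AE x in lebesgue_on \<Omega>. \<forall>k\<in>S. x \<in> smallest_patch \<Omega> \<T> (\<phi> k) \<longrightarrow>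
      (\<forall>\<xi>\<in>carrier_vec m. 0 \<le> \<alpha> * scalar_prod \<xi> (C x *\<^sub>v \<xi>) + \<beta> * scalar_prod \<xi> (Ct x *\<^sub>v \<xi>))"
    by (rule AE_ball_countable'[OF nonneg]) (use S finite_subset in \<open>auto intro!: countable_finite\<close>)
  moreover have "AE x in lebesgue_on \<Omega>. x \<notin> (\<Union>k\<in>S. smallest_patch \<Omega> \<T> (\<phi> k)) \<longrightarrow> fe_strain v x = 0\<^sub>v m"
    by (rule strain_eq_0_off_patches[OF \<T> S v(2)])
  ultimately have "AE x in lebesgue_on \<Omega>. 0 \<le> ?q x"
    using AE_material_spd[OF C(1)] AE_material_spd[OF C(2)]
  proof eventually_elim
    case (elim x)
    show ?case
    proof (cases "x \<in> (\<Union>k\<in>S. smallest_patch \<Omega> \<T> (\<phi> k))")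
      case True
      then show ?thesis using elim(1) fe_strain_carrier by blast
    next
      case False
      then have "fe_strain v x = 0\<^sub>v m" using elim(2) by blast
      then show ?thesis using elim(3,4) by (auto simp: symmetric_positive_definite_def)
    qed
  qed
  then have "0 \<le> (\<integral>x. ?q x \<partial>lebesgue_on \<Omega>)" by (rule integral_nonneg_AE)
  then show ?thesis
    using energy_integrable[OF C(1)] energy_integrable[OF C(2)]
      stiffness_form[OF A(1) v(1) v(1)] stiffness_form[OF A(2) v(1) v(1)] by simp
qed

lemma form_ge_of_ess_inf:
  assumes \<T>: "element_decomposition \<Omega> \<T>" and C: "material_data m \<Omega> C" "material_data m \<Omega> Ct"
    and A: "is_stiffness_matrix d b \<Omega> N \<phi> C A" "is_stiffness_matrix d b \<Omega> N \<phi> Ct At"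
    and S: "S \<subseteq> {1..N}"
    and v: "v \<in> carrier_vec (d * N)"
      "\<And>i k. i \<in> {1..d} \<Longrightarrow> k \<in> {1..N} - S \<Longrightarrow> v $ ((i - 1) * N + (k - 1)) = 0"
    and t: "\<And>k. k \<in> S \<Longrightarrow>
      ereal t \<le> ess_inf_on (smallest_patch \<Omega> \<T> (\<phi> k)) (\<lambda>x. lambda_min (inv_mat (Ct x) * C x))"
  shows "t * scalar_prod v (At *\<^sub>v v) \<le> scalar_prod v (A *\<^sub>v v)"
proof -
  have pointwise: "AE x in lebesgue_on \<Omega>. x \<in> smallest_patch \<Omega> \<T> (\<phi> k) \<longrightarrow>
      (\<forall>\<xi>\<in>carrier_vec m. 0 \<le> 1 * scalar_prod \<xi> (C x *\<^sub>v \<xi>) + (- t) * scalar_prod \<xi> (Ct x *\<^sub>v \<xi>))"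
    if k: "k \<in> S" for k
  proof -
    have "k \<in> {1..N}" using S k by blast
    from AE_lebesgue_on_ge_ess_inf[OF patch_closed_cover(1)[OF \<T> this] \<Omega>(1) t[OF k]]
      AE_material_spd[OF C(1)] AE_material_spd[OF C(2)]
    show ?thesis
    proof eventually_elim
      case (elim x)
      show ?case
      proof (intro impI ballI)
        fix \<xi> :: "real vec" assume "x \<in> smallest_patch \<Omega> \<T> (\<phi> k)" "\<xi> \<in> carrier_vec m"
        then have "t * scalar_prod \<xi> (Ct x *\<^sub>v \<xi>) \<le> scalar_prod \<xi> (C x *\<^sub>v \<xi>)"
          using elim dm by (intro lambda_min_pencil_form_le[of _ m]) (auto simp: symmetric_positive_definite_def)
        then show "0 \<le> 1 * scalar_prod \<xi> (C x *\<^sub>v \<xi>) + (- t) * scalar_prod \<xi> (Ct x *\<^sub>v \<xi>)" by simp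
      qed
    qed
  qed
  have "0 \<le> 1 * scalar_prod v (A *\<^sub>v v) + (- t) * scalar_prod v (At *\<^sub>v v)"
    by (rule form_combination_nonneg[OF \<T> C A S v pointwise])
  then show ?thesis by simp
qed

lemma form_le_of_ess_sup:
  assumes \<T>: "element_decomposition \<Omega> \<T>" and C: "material_data m \<Omega> C" "material_data m \<Omega> Ct"
    and A: "is_stiffness_matrix d b \<Omega> N \<phi> C A" "is_stiffness_matrix d b \<Omega> N \<phi> Ct At"
    and S: "S \<subseteq> {1..N}"
    and v: "v \<in> carrier_vec (d * N)"
      "\<And>i k. i \<in> {1..d} \<Longrightarrow> k \<in> {1..N} - S \<Longrightarrow> v $ ((i - 1) * N + (k - 1)) = 0"
    and t: "\<And>k. k \<in> S \<Longrightarrow>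
      ess_sup_on (smallest_patch \<Omega> \<T> (\<phi> k)) (\<lambda>x. lambda_max (inv_mat (Ct x) * C x)) \<le> ereal t"
  shows "scalar_prod v (A *\<^sub>v v) \<le> t * scalar_prod v (At *\<^sub>v v)"
proof -
  have pointwise: "AE x in lebesgue_on \<Omega>. x \<in> smallest_patch \<Omega> \<T> (\<phi> k) \<longrightarrow>
      (\<forall>\<xi>\<in>carrier_vec m. 0 \<le> (- 1) * scalar_prod \<xi> (C x *\<^sub>v \<xi>) + t * scalar_prod \<xi> (Ct x *\<^sub>v \<xi>))"
    if k: "k \<in> S" for k
  proof -
    have "k \<in> {1..N}" using S k by blast
    from AE_lebesgue_on_le_ess_sup[OF patch_closed_cover(1)[OF \<T> this] \<Omega>(1) t[OF k]]
      AE_material_spd[OF C(1)] AE_material_spd[OF C(2)]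
    show ?thesis
    proof eventually_elim
      case (elim x)
      show ?case
      proof (intro impI ballI)
        fix \<xi> :: "real vec" assume "x \<in> smallest_patch \<Omega> \<T> (\<phi> k)" "\<xi> \<in> carrier_vec m"
        then have "scalar_prod \<xi> (C x *\<^sub>v \<xi>) \<le> t * scalar_prod \<xi> (Ct x *\<^sub>v \<xi>)"
          using elim dm by (intro form_le_lambda_max_pencil[of _ m]) (auto simp: symmetric_positive_definite_def)
        then show "0 \<le> (- 1) * scalar_prod \<xi> (C x *\<^sub>v \<xi>) + t * scalar_prod \<xi> (Ct x *\<^sub>v \<xi>)" by simp
      qed
    qed
  qed
  have "0 \<le> (- 1) * scalar_prod v (A *\<^sub>v v) + t * scalar_prod v (At *\<^sub>v v)"
    by (rule form_combination_nonneg[OF \<T> C A S v pointwise])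
  then show ?thesis by simp
qed

end

section \<open>Eigenvalue bounds for the preconditioned stiffness matrix\<close>

text \<open>The bounds are repeated node by node, whereas coefficient vectors are stored component by component.
  The item \<open>j\<close> of the repeated series, counted from \<open>1\<close>, corresponds to the coefficient
  \<open>coordinate d N j\<close>, counted from \<open>0\<close>.\<close>

definition coordinate :: "nat \<Rightarrow> nat \<Rightarrow> nat \<Rightarrow> nat" where
  "coordinate d N j = ((j - 1) mod d) * N + (j - 1) div d"

lemma coordinate_less:
  assumes "j \<in> {1..d * N}"
  shows "coordinate d N j < d * N"
proof -
  have "0 < d" using assms by (cases d) auto
  have "(j - 1) div d < N" using assms by (intro less_mult_imp_div_less) (auto simp: mult.commute)
  then have "coordinate d N j < Suc ((j - 1) mod d) * N" by (simp add: coordinate_def)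
  also have "\<dots> \<le> d * N" using \<open>0 < d\<close> by (intro mult_le_mono1) (simp add: Suc_leI)
  finally show ?thesis .
qed

lemma coordinate_block:
  assumes "i \<in> {1..d}" "k \<in> {1..N}"
  shows "(k - 1) * d + i \<in> {(k - 1) * d + 1..k * d}"
    and "coordinate d N ((k - 1) * d + i) = (i - 1) * N + (k - 1)"
proof -
  obtain i' where i: "i = Suc i'" "i' < d" using assms by (cases i) auto
  obtain k' where k: "k = Suc k'" using assms by (cases k) auto
  show "(k - 1) * d + i \<in> {(k - 1) * d + 1..k * d}" using i k by simp
  show "coordinate d N ((k - 1) * d + i) = (i - 1) * N + (k - 1)"
    using i k by (simp add: coordinate_def)
qed

lemma block_subset:
  fixes k d N :: nat
  assumes "k \<in> {1..N}"
  shows "{(k - 1) * d + 1..k * d} \<subseteq> {1..d * N}"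
proof
  fix j assume j: "j \<in> {(k - 1) * d + 1..k * d}"
  have "k * d \<le> N * d" using assms by (intro mult_le_mono1) auto
  moreover have "(k - 1) * d + 1 \<le> j" "j \<le> k * d" using j by auto
  ultimately have "1 \<le> j" "j \<le> N * d" by linarith+
  then show "j \<in> {1..d * N}" by (simp add: mult.commute)
qed

theorem theorem4p5:
  fixes \<Omega> :: "'a::euclidean_space set"
    and b :: "nat \<Rightarrow> 'a"
    and \<T> :: "'a set set"
    and \<phi> :: "nat \<Rightarrow> 'a \<Rightarrow> real"
    and C Ct :: "'a \<Rightarrow> real mat"
    and A At :: "real mat"
    and d m N :: nat
    and lam :: "nat \<Rightarrow> real"
    and hatL hatU lamL lamU :: "nat \<Rightarrow> ereal"
    and r s :: "nat \<Rightarrow> nat"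
  assumes "d = DIM('a)"
    and "d = 2 \<and> m = 3 \<or> d = 3 \<and> m = 6"
    and "bij_betw b {1..d} Basis"
    and "polyhedral_domain \<Omega>"
    and "element_decomposition \<Omega> \<T>"
    and "material_data m \<Omega> C"
    and "material_data m \<Omega> Ct"
    and "\<forall>k\<in>{1..N}. \<phi> k \<in> V0_cont \<Omega>"
    and "\<forall>c :: nat \<Rightarrow> real. (\<forall>x\<in>\<Omega>. (\<Sum>k=1..N. c k * \<phi> k x) = 0) \<longrightarrow> (\<forall>k\<in>{1..N}. c k = 0)"
    and "is_stiffness_matrix d b \<Omega> N \<phi> C A"
    and "is_stiffness_matrix d b \<Omega> N \<phi> Ct At"
    and "\<forall>k\<in>{1..d * N}. lam k = eigenvalue_list (inv_mat At * A) ! (k - 1)"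
    and "\<forall>k\<in>{1..N}. hatL k =
           ess_inf_on (smallest_patch \<Omega> \<T> (\<phi> k)) (\<lambda>x. lambda_min (inv_mat (Ct x) * C x))"
    and "\<forall>k\<in>{1..N}. hatU k =
           ess_sup_on (smallest_patch \<Omega> \<T> (\<phi> k)) (\<lambda>x. lambda_max (inv_mat (Ct x) * C x))"
    and "\<forall>k\<in>{1..N}. \<forall>j\<in>{(k - 1) * d + 1..k * d}. lamL j = hatL k \<and> lamU j = hatU k"
    and "bij_betw r {1..d * N} {1..d * N}"
    and "bij_betw s {1..d * N} {1..d * N}"
    and "mono_on {1..d * N} (\<lambda>k. lamL (r k))"
    and "mono_on {1..d * N} (\<lambda>k. lamU (s k))"
  shows "length (eigenvalue_list (inv_mat At * A)) = d * N
    \<and> (\<forall>k\<in>{1..d * N}. 0 < lam k)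
    \<and> (\<forall>k\<in>{1..d * N}. lamL (r k) \<le> ereal (lam k) \<and> ereal (lam k) \<le> lamU (s k))"
proof -
  note dim = assms(2) and \<T> = assms(5) and C = assms(6,7) and A = assms(10,11)
  note hatL = assms(13) and hatU = assms(14) and repeated = assms(15)
  let ?n = "d * N"
  interpret fe_space \<Omega> b \<phi> d m N
  proof
    show "open \<Omega>" "bounded \<Omega>" using assms(4) by (auto simp: polyhedral_domain_def)
    show "b i \<in> Basis" if "i \<in> {1..d}" for i using assms(3) that by (rule bij_betwE[THEN bspec])
  qed (use assms(2,8,9) in auto)
  have spd: "symmetric_positive_definite ?n A" "symmetric_positive_definite ?n At"
    using stiffness_spd[OF C(1) A(1)] stiffness_spd[OF C(2) A(2)] by auto
  then have mats: "A \<in> carrier_mat ?n ?n" "transpose_mat A = A" "At \<in> carrier_mat ?n ?n" "transpose_mat At = At"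
    and pos: "\<And>v. v \<in> carrier_vec ?n \<Longrightarrow> v \<noteq> 0\<^sub>v ?n \<Longrightarrow> 0 < scalar_prod v (A *\<^sub>v v)"
      "\<And>v. v \<in> carrier_vec ?n \<Longrightarrow> v \<noteq> 0\<^sub>v ?n \<Longrightarrow> 0 < scalar_prod v (At *\<^sub>v v)"
    by (auto simp: symmetric_positive_definite_def)
  obtain e \<mu> where sys: "pencil_eigensystem ?n A At ?n e \<mu>"
    using generalized_spectral_theorem[OF mats pos(2)] by blast
  have eigs: "eigenvalue_list (inv_mat At * A) = map \<mu> [0..<?n]"
    by (rule eigenvalue_list_pencil[OF sys mats(1,3) pos(2)])
  have lam: "lam k = \<mu> (k - 1)" if "k \<in> {1..?n}" for k
    using assms(12) that eigs by auto
  have \<mu>_pos: "0 < \<mu> i" if i: "i < ?n" for i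
  proof -
    have e: "e i \<in> carrier_vec ?n" "A *\<^sub>v e i = \<mu> i \<cdot>\<^sub>v (At *\<^sub>v e i)" "scalar_prod (e i) (At *\<^sub>v e i) = 1"
      using sys i by (auto simp: pencil_eigensystem_def)
    then have "e i \<noteq> 0\<^sub>v ?n" using mats(3) by auto
    then have "0 < scalar_prod (e i) (A *\<^sub>v e i)" using pos(1) e(1) by blast
    also have "\<dots> = \<mu> i" using e mats(3) by simp
    finally show ?thesis .
  qed
  \<comment> \<open>If the coefficients with indices in \<open>R\<close> vanish, a node can contribute only if one of its \<open>d\<close>
      indices lies outside \<open>R\<close>.\<close>
  define active where "active R = {k \<in> {1..N}. \<not> {(k - 1) * d + 1..k * d} \<subseteq> R}" for R
  have active_sub: "active R \<subseteq> {1..N}" for R by (auto simp: active_def)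
  have active_witness: "\<exists>j\<in>{1..?n} - R. lamL j = hatL k \<and> lamU j = hatU k" if active: "k \<in> active R" for k R
  proof -
    have k: "k \<in> {1..N}" using active by (simp add: active_def)
    obtain j where j: "j \<in> {(k - 1) * d + 1..k * d}" "j \<notin> R" using active unfolding active_def by blast
    then have "j \<in> {1..?n}" using block_subset[OF k] by blast
    then show ?thesis using repeated k j by blast
  qed
  have inactive_zero: "v $ ((i - 1) * N + (k - 1)) = 0"
    if v: "\<forall>l\<in>coordinate d N ` R. v $ l = 0" and i: "i \<in> {1..d}" and k: "k \<in> {1..N} - active R"
    for v :: "real vec" and i k R
  proof -
    have k': "k \<in> {1..N}" "{(k - 1) * d + 1..k * d} \<subseteq> R" using k by (auto simp: active_def)
    then have "(k - 1) * d + i \<in> R" using coordinate_block(1)[OF i k'(1)] by blast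
    then have "v $ coordinate d N ((k - 1) * d + i) = 0" using v by blast
    then show ?thesis using coordinate_block(2)[OF i k'(1)] by simp
  qed
  have J_sub: "coordinate d N ` p ` K \<subseteq> {..<?n}"
    if "bij_betw p {1..?n} {1..?n}" "K \<subseteq> {1..?n}" for p K
  proof -
    have "p j \<in> {1..?n}" if "j \<in> K" for j
      using bij_betwE[OF \<open>bij_betw p {1..?n} {1..?n}\<close>] \<open>K \<subseteq> {1..?n}\<close> that by blast
    then show ?thesis using coordinate_less by blast
  qed
  have lower: "lamL (r k) \<le> ereal (lam k)" if k: "k \<in> {1..?n}" for k
  proof (rule ccontr)
    assume "\<not> ?thesis"
    then have "ereal (lam k) < lamL (r k)" by (simp add: not_le)
    then obtain t where "ereal (lam k) < ereal t" "ereal t < lamL (r k)"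
      using ereal_dense2 by blast
    then have t: "lam k < t" "ereal t < lamL (r k)" by simp_all
    \<comment> \<open>Discarding the \<open>k - 1\<close> smallest bounds leaves only bounds that exceed \<open>t\<close>. The real number \<open>t\<close>
        makes the argument independent of whether \<open>lamL (r k)\<close> is finite.\<close>
    define R where "R = r ` {1..<k}"
    have tS: "ereal t \<le> ess_inf_on (smallest_patch \<Omega> \<T> (\<phi> i)) (\<lambda>x. lambda_min (inv_mat (Ct x) * C x))"
      if i: "i \<in> active R" for i
    proof -
      obtain j where j: "j \<in> {1..?n}" "j \<notin> R" "lamL j = hatL i" using active_witness[OF i] by blast
      have "j \<in> r ` {1..?n}" using j(1) bij_betw_imp_surj_on[OF assms(16)] by simp
      then obtain l where l: "l \<in> {1..?n}" "j = r l" by blast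
      have "k \<le> l" using l j(2) by (force simp: R_def)
      then have "lamL (r k) \<le> lamL (r l)" using mono_onD[OF assms(18) k l(1)] by simp
      then show ?thesis using t(2) j(3) l(2) hatL i active_sub by force
    qed
    have "t \<le> \<mu> (k - 1)"
    proof (rule eigenvalue_lower_bound[OF sys mats(1,3)])
      show "coordinate d N ` R \<subseteq> {..<?n}"
        unfolding R_def using k by (intro J_sub[OF assms(16)]) auto
      have "card (coordinate d N ` R) \<le> card {1..<k}"
        unfolding R_def image_image by (rule card_image_le) simp
      then show "card (coordinate d N ` R) \<le> k - 1" by simp
      show "k - 1 < ?n" using k by auto
      show "t * scalar_prod v (At *\<^sub>v v) \<le> scalar_prod v (A *\<^sub>v v)"
        if "v \<in> carrier_vec ?n" "\<forall>j\<in>coordinate d N ` R. v $ j = 0" for v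
        by (rule form_ge_of_ess_inf[OF \<T> C A active_sub that(1) inactive_zero[OF that(2)] tS])
    qed
    then show False using t(1) lam[OF k] by simp
  qed
  have upper: "ereal (lam k) \<le> lamU (s k)" if k: "k \<in> {1..?n}" for k
  proof (rule ccontr)
    assume "\<not> ?thesis"
    then have "lamU (s k) < ereal (lam k)" by (simp add: not_le)
    then obtain t where "lamU (s k) < ereal t" "ereal t < ereal (lam k)"
      using ereal_dense2 by blast
    then have t: "lamU (s k) < ereal t" "t < lam k" by simp_all
    \<comment> \<open>Discarding the \<open>?n - k\<close> largest bounds leaves only bounds below \<open>t\<close>.\<close>
    define R where "R = s ` {k<..?n}"
    have tS: "ess_sup_on (smallest_patch \<Omega> \<T> (\<phi> i)) (\<lambda>x. lambda_max (inv_mat (Ct x) * C x)) \<le> ereal t"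
      if i: "i \<in> active R" for i
    proof -
      obtain j where j: "j \<in> {1..?n}" "j \<notin> R" "lamU j = hatU i" using active_witness[OF i] by blast
      have "j \<in> s ` {1..?n}" using j(1) bij_betw_imp_surj_on[OF assms(17)] by simp
      then obtain l where l: "l \<in> {1..?n}" "j = s l" by blast
      have "l \<le> k" using l j(2) by (force simp: R_def)
      then have "lamU (s l) \<le> lamU (s k)" using mono_onD[OF assms(19) l(1) k] by simp
      then show ?thesis using t(1) j(3) l(2) hatU i active_sub by force
    qed
    have "\<mu> (k - 1) \<le> t"
    proof (rule eigenvalue_upper_bound[OF sys mats(1,3)])
      show "coordinate d N ` R \<subseteq> {..<?n}"
        unfolding R_def using k by (intro J_sub[OF assms(17)]) auto
      have "card (coordinate d N ` R) \<le> card {k<..?n}"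
        unfolding R_def image_image by (rule card_image_le) simp
      then show "card (coordinate d N ` R) < ?n - (k - 1)" using k by auto
      show "k - 1 < ?n" using k by auto
      show "scalar_prod v (A *\<^sub>v v) \<le> t * scalar_prod v (At *\<^sub>v v)"
        if "v \<in> carrier_vec ?n" "\<forall>j\<in>coordinate d N ` R. v $ j = 0" for v
        by (rule form_le_of_ess_sup[OF \<T> C A active_sub that(1) inactive_zero[OF that(2)] tS])
    qed
    then show False using t(2) lam[OF k] by simp
  qed
  have "length (eigenvalue_list (inv_mat At * A)) = ?n" by (simp add: eigs)
  moreover have "0 < lam k" if "k \<in> {1..?n}" for k
    using lam[OF that] \<mu>_pos[of "k - 1"] that by auto
  ultimately show ?thesis using lower upper by blast
qed

end
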